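(* Fix an integer $k\ge 0$ and a sequence $\bm\delta=(\delta_1,\dots,\delta_k)$ of positive reals, and let $x,y\in[0,1]$ (with $x=y$ when $k=0$). Then \[C_k(n^{x},n,\dots,n,n^{y})=\tilde O\left(n^{\frac{f(k)+x+y}{3}}\right),\] where $f(k)=k+2$ if $k\equiv 2\pmod 3$ and $f(k)=k+1$ otherwise. (Here the first argument is $n^x$, the last is $n^y$, and the $k-1$ middle arguments equal $n$.)
   Context: For a fixed $\bm\delta=(\delta_1,\dots,\delta_k)$ and sets $P_1,\dots,P_{k+1}\subseteq\mathbb{R}^2$, let $C_k(P_1,\dots,P_{k+1})$ be the number of $(k+1)$-tuples $(p_1,\dots,p_{k+1})$ with $p_i\in P_i$ for all $i$, $\|p_i-p_{i+1}\|=\delta_i$ for all $i\in[k]$, and $p_i\ne p_j$ for $i\ne j$. Let $C_k(n_1,\dots,n_{k+1})$ be the maximum of $C_k(P_1,\dots,P_{k+1})$ over all $P_1,\dots,P_{k+1}\subseteq\mathbb{R}^2$ with $|P_i|\le n_i$. $f(n)=\tilde O(g(n))$ means there are positive constants $c,C$ with $f(n)/g(n)\le C\log^c n$ for all sufficiently large $n$. *)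

theory Defs
  imports "HOL-Analysis.Analysis"
begin

(* Points of R^2 are modelled as real \<times> real; dist on real \<times> real is the Euclidean distance.
   A (k+1)-tuple (p_1,...,p_{k+1}) is a function p on {0..k} (p_i = p (i-1));
   delta_i = \<delta> (i-1), and P_i = P (i-1). *)

definition chain_tuples ::
  "nat \<Rightarrow> (nat \<Rightarrow> real) \<Rightarrow> (nat \<Rightarrow> (real \<times> real) set) \<Rightarrow> (nat \<Rightarrow> real \<times> real) set" where
  "chain_tuples k \<delta> P =
     {p \<in> {0..k} \<rightarrow>\<^sub>E UNIV.
        (\<forall>i\<le>k. p i \<in> P i) \<and>
        (\<forall>i<k. dist (p i) (p (Suc i)) = \<delta> i) \<and>
        inj_on p {0..k}}"

definition Ck :: "nat \<Rightarrow> (nat \<Rightarrow> real) \<Rightarrow> (nat \<Rightarrow> (real \<times> real) set) \<Rightarrow> nat" where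
  "Ck k \<delta> P = card (chain_tuples k \<delta> P)"

definition Ck_max :: "nat \<Rightarrow> (nat \<Rightarrow> real) \<Rightarrow> (nat \<Rightarrow> real) \<Rightarrow> real" where
  "Ck_max k \<delta> ns =
     Sup {real (Ck k \<delta> P) | P. \<forall>i\<le>k. finite (P i) \<and> real (card (P i)) \<le> ns i}"

definition fk :: "nat \<Rightarrow> nat" where
  "fk k = (if k mod 3 = 2 then k + 2 else k + 1)"

definition sizes :: "nat \<Rightarrow> real \<Rightarrow> real \<Rightarrow> nat \<Rightarrow> nat \<Rightarrow> real" where
  "sizes k x y n i =
     (if i = 0 then real n powr x else if i = k then real n powr y else real n)"

end

theory Submission
  imports Defs
begin

text \<open>Write \<open>a\<close> and \<open>b\<close> for the sizes of the first and last sets. By induction on \<open>k\<close> the number of chains is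
  at most \<open>n\<^bsup>f(k)/3\<^esup> (a b)\<^bsup>1/3\<^esup>\<close> up to powers of \<open>log n\<close>. Split the second set dyadically by the number \<open>r\<close> of
  neighbours in the first. By the Szemeredi--Trotter bound for circles of equal radius, either the two
  sets span few unit distances, about \<open>a\<close> of them, and then one skips to the fourth point, the third being determined up
  to two choices; or the class has at most about \<open>a\<^sup>2/r\<^sup>3\<close> points, and one drops the first point at the
  cost of a factor \<open>r\<close>. If \<open>k\<close> is divisible by 3, the latter must be done at both ends simultaneously,
  unless \<open>a\<^sup>2 \<le> n\<close> or \<open>b\<^sup>2 \<le> n\<close>, where leaving out the second point, determined up to two choices by its neighbours,
  is enough.

  The incidence bound itself only needs to hold up to a logarithm, which gives an elementary
  route to the crossing lemma: upper half circles of equal radius are \<open>x\<close>-monotone pseudo-segments,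
  and a graph drawn with non-crossing \<open>x\<close>-monotone edges has \<open>O(v log v)\<close> edges, because the edges
  over a vertical line, ordered by height, have end points that form sequences without
  alternation \<open>abab\<close>.\<close>

section \<open>Graphs with monotone edges\<close>

lemma card_colour_ends_le:
  fixes \<phi> :: "'e \<Rightarrow> real" and l :: "'e \<Rightarrow> 'c"
  assumes fin: "finite L" and inj: "inj_on \<phi> X" and l: "l ` X \<subseteq> L"
  shows "finite {x \<in> X. \<forall>y\<in>X. l y = l x \<longrightarrow> \<phi> y \<le> \<phi> x}" (is "finite ?A")
    and "card {x \<in> X. \<forall>y\<in>X. l y = l x \<longrightarrow> \<phi> y \<le> \<phi> x} \<le> card L"
proof -
  have "inj_on l ?A"
    by (rule inj_onI) (use inj in \<open>force simp: inj_on_def intro: antisym\<close>)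
  moreover have "l ` ?A \<subseteq> L" using l by auto
  ultimately show "finite ?A" "card ?A \<le> card L"
    using fin by (auto intro: card_inj_on_le inj_on_finite)
qed

text \<open>List \<open>X\<close> in the order of \<open>\<phi>\<close>. Between consecutive
  elements at least one of the labels \<open>l\<close>, \<open>r\<close> changes. If
  \<open>l\<close> changes between \<open>x\<close> and its successor \<open>y\<close>, then
  \<open>x\<close> is the last element of its colour or \<open>y\<close> the first of its colour:
  otherwise an earlier element coloured like \<open>y\<close> and a later one coloured like
  \<open>x\<close> would complete an alternation. Each colour has one first and one last element,
  hence the factors 2. The top element of \<open>X\<close> is the last of its colour and is counted
  as well.\<close>

lemma card_alternation_free_le:
  fixes \<phi> :: "'e \<Rightarrow> real" and l r :: "'e \<Rightarrow> 'c"
  assumes fX: "finite X" and fL: "finite L" and fR: "finite R"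
    and inj: "inj_on \<phi> X" and l: "l ` X \<subseteq> L" and r: "r ` X \<subseteq> R"
    and lr: "inj_on (\<lambda>x. (l x, r x)) X"
    and nl: "\<And>s t u v. \<lbrakk>s \<in> X; t \<in> X; u \<in> X; v \<in> X; \<phi> s < \<phi> t; \<phi> t < \<phi> u; \<phi> u < \<phi> v;
               l s = l u; l t = l v\<rbrakk> \<Longrightarrow> l s = l t"
    and nr: "\<And>s t u v. \<lbrakk>s \<in> X; t \<in> X; u \<in> X; v \<in> X; \<phi> s < \<phi> t; \<phi> t < \<phi> u; \<phi> u < \<phi> v;
               r s = r u; r t = r v\<rbrakk> \<Longrightarrow> r s = r t"
  shows "card X \<le> 2 * card L + 2 * card R"
proof -
  \<comment> \<open>\<open>nx x y\<close> says that \<open>y\<close> is the immediate successor of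
    \<open>x\<close> in the order of \<open>\<phi>\<close>; \<open>La\<close> and \<open>Fi\<close>
    collect the last and first elements of the colours.\<close>
  define nx where "nx x y \<longleftrightarrow> y \<in> X \<and> \<phi> x < \<phi> y \<and> (\<forall>z\<in>X. \<phi> x < \<phi> z \<longrightarrow> \<phi> y \<le> \<phi> z)" for x y
  have nx_inj: "x = x'" if "nx x y" "nx x' y" "x \<in> X" "x' \<in> X" for x x' y
    using that inj unfolding nx_def inj_on_def by (metis leD linorder_neqE_linordered_idom)
  define La where "La m = {x \<in> X. \<forall>y\<in>X. m y = m x \<longrightarrow> \<phi> y \<le> \<phi> x}" for m :: "'e \<Rightarrow> 'c"
  define Fi where "Fi m = {x \<in> X. \<forall>y\<in>X. m y = m x \<longrightarrow> \<phi> x \<le> \<phi> y}" for m :: "'e \<Rightarrow> 'c"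
  have *: "finite (La m) \<and> card (La m) \<le> card M \<and> finite {x\<in>X. \<exists>y\<in>Fi m. nx x y} \<and>
      card {x\<in>X. \<exists>y\<in>Fi m. nx x y} \<le> card M" if "finite M" "m ` X \<subseteq> M" for m :: "'e \<Rightarrow> 'c" and M
  proof -
    have a: "finite (La m)" "card (La m) \<le> card M"
      using card_colour_ends_le[OF that(1) inj that(2)] unfolding La_def by auto
    have "inj_on (\<lambda>x. - \<phi> x) X" using inj by (auto simp: inj_on_def)
    from card_colour_ends_le[OF that(1) this that(2)]
    have b: "finite (Fi m)" "card (Fi m) \<le> card M" unfolding Fi_def by auto
    have ex: "\<forall>x\<in>{x\<in>X. \<exists>y\<in>Fi m. nx x y}. \<exists>y. y \<in> Fi m \<and> nx x y" by auto
    then obtain g where g: "\<And>x. x\<in>{x\<in>X. \<exists>y\<in>Fi m. nx x y} \<Longrightarrow> g x \<in> Fi m \<and> nx x (g x)" by metis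
    have "inj_on g {x\<in>X. \<exists>y\<in>Fi m. nx x y}"
      by (rule inj_onI) (metis (mono_tags, lifting) g mem_Collect_eq nx_inj)
    moreover have "g ` {x\<in>X. \<exists>y\<in>Fi m. nx x y} \<subseteq> Fi m" using g by auto
    ultimately have "card {x\<in>X. \<exists>y\<in>Fi m. nx x y} \<le> card (Fi m)"
      using b(1) by (rule card_inj_on_le)
    then show ?thesis using a b fX by auto
  qed
  have change: "x \<in> La m \<union> {x\<in>X. \<exists>y\<in>Fi m. nx x y}"
    if "x \<in> X" "nx x y" "m x \<noteq> m y"
     and nm: "\<And>s t u v. \<lbrakk>s \<in> X; t \<in> X; u \<in> X; v \<in> X; \<phi> s < \<phi> t; \<phi> t < \<phi> u; \<phi> u < \<phi> v;
               m s = m u; m t = m v\<rbrakk> \<Longrightarrow> m s = m t" for x y and m :: "'e \<Rightarrow> 'c"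
  proof (rule ccontr)
    assume n: "\<not> ?thesis"
    have y: "y \<in> X" "\<phi> x < \<phi> y" and z: "\<And>z. z\<in>X \<Longrightarrow> \<phi> x < \<phi> z \<Longrightarrow> \<phi> y \<le> \<phi> z"
      using that(2) unfolding nx_def by auto
    from n that(1) obtain v where v: "v \<in> X" "m v = m x" "\<phi> v > \<phi> x"
      unfolding La_def by force
    from n that(1,2) y have "y \<notin> Fi m" by auto
    then obtain s where s: "s \<in> X" "m s = m y" "\<phi> s < \<phi> y" using y unfolding Fi_def by force
    have "s \<noteq> x" "v \<noteq> y" using s v that(3) by auto
    then have "\<phi> s \<noteq> \<phi> x" "\<phi> v \<noteq> \<phi> y" using inj s(1) v(1) that(1) y(1) unfolding inj_on_def by auto
    with z[of s] z[of v] s v have "\<phi> s < \<phi> x" "\<phi> y < \<phi> v" by force+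
    from nm[OF s(1) that(1) y(1) v(1) this(1) y(2) this(2) s(2)] v(2) s(2) that(3)
    show False by auto
  qed
  have "X \<subseteq> (La l \<union> {x\<in>X. \<exists>y\<in>Fi l. nx x y}) \<union> (La r \<union> {x\<in>X. \<exists>y\<in>Fi r. nx x y})"
  proof
    fix x assume x: "x \<in> X"
    show "x \<in> (La l \<union> {x\<in>X. \<exists>y\<in>Fi l. nx x y}) \<union> (La r \<union> {x\<in>X. \<exists>y\<in>Fi r. nx x y})"
    proof (cases "\<forall>y\<in>X. \<phi> y \<le> \<phi> x")
      case True then show ?thesis using x unfolding La_def by auto
    next
      case False
      define U where "U = {y\<in>X. \<phi> x < \<phi> y}"
      have U: "finite U" "U \<noteq> {}" using False fX unfolding U_def by (auto simp: not_le)
      obtain y where "y \<in> U" "\<forall>z\<in>U. \<phi> y \<le> \<phi> z"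
        using ex_is_arg_min_if_finite[OF U, of \<phi>] unfolding is_arg_min_def by (auto simp: not_less)
      then have nx: "nx x y" unfolding nx_def U_def by auto
      then have "y \<in> X" "x \<noteq> y" unfolding nx_def by auto
      then have "l x \<noteq> l y \<or> r x \<noteq> r y" using lr x unfolding inj_on_def by auto
      then show ?thesis
      proof
        assume "l x \<noteq> l y" 
        have "x \<in> La l \<union> {x\<in>X. \<exists>y\<in>Fi l. nx x y}"
          by (rule change[OF x nx \<open>l x \<noteq> l y\<close>]) (rule nl)
        then show ?thesis by blast
      next
        assume "r x \<noteq> r y" 
        have "x \<in> La r \<union> {x\<in>X. \<exists>y\<in>Fi r. nx x y}"
          by (rule change[OF x nx \<open>r x \<noteq> r y\<close>]) (rule nr)
        then show ?thesis by blast
      qed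
    qed
  qed
  then have "card X \<le> card ((La l \<union> {x\<in>X. \<exists>y\<in>Fi l. nx x y}) \<union> (La r \<union> {x\<in>X. \<exists>y\<in>Fi r. nx x y}))"
    using *[OF fL l] *[OF fR r] by (intro card_mono) auto
  also have "\<dots> \<le> (card (La l) + card {x\<in>X. \<exists>y\<in>Fi l. nx x y}) + (card (La r) + card {x\<in>X. \<exists>y\<in>Fi r. nx x y})"
    by (meson add_mono card_Un_le order_trans)
  also have "\<dots> \<le> 2 * card L + 2 * card R"
    using *[OF fL l] *[OF fR r] by auto
  finally show ?thesis .
qed

section \<open>Drawings with x-monotone arcs\<close>

definition overlap :: "real \<times> real \<Rightarrow> real \<times> real \<Rightarrow> real set" where
  "overlap e e' = {fst e<..<snd e} \<inter> {fst e'<..<snd e'}"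

definition cross :: "(real \<times> real \<Rightarrow> real \<Rightarrow> real) \<Rightarrow> real \<times> real \<Rightarrow> real \<times> real \<Rightarrow> bool" where
  "cross F e e' \<longleftrightarrow> e \<noteq> e' \<and> (\<exists>x\<in>overlap e e'. F e x = F e' x)"

text \<open>The real \<open>v\<close> stands for the vertex \<open>(v, \<eta> v)\<close>, so
  distinct vertices have distinct abscissae. An edge is the pair of abscissae of its ends, left end
  first, drawn as the graph of \<open>F e\<close>. Multiple edges are excluded because
  \<open>E\<close> is a set of pairs, and the last clause keeps an arc from passing through a vertex
  other than its ends. As \<open>cross\<close> only looks at the open overlap, a common end is not a
  crossing.\<close>

definition arc_graph ::
  "(real \<Rightarrow> real) \<Rightarrow> (real \<times> real \<Rightarrow> real \<Rightarrow> real) \<Rightarrow> real set \<Rightarrow> (real \<times> real) set \<Rightarrow> bool" where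
  "arc_graph \<eta> F V E \<longleftrightarrow> finite V \<and> E \<subseteq> V \<times> V \<and>
     (\<forall>e\<in>E. fst e < snd e \<and> continuous_on {fst e..snd e} (F e) \<and>
        F e (fst e) = \<eta> (fst e) \<and> F e (snd e) = \<eta> (snd e) \<and>
        (\<forall>v\<in>V. fst e < v \<and> v < snd e \<longrightarrow> F e v \<noteq> \<eta> v))"

lemma arc_graph_subset:
  "arc_graph \<eta> F V E \<Longrightarrow> W \<subseteq> V \<Longrightarrow> D \<subseteq> E \<Longrightarrow> D \<subseteq> W \<times> W \<Longrightarrow> arc_graph \<eta> F W D"
  unfolding arc_graph_def by (auto intro: finite_subset) (metis in_mono fst_conv snd_conv)+

text \<open>If the difference of the two arcs changed sign between \<open>x\<close> and
  \<open>u\<close>, the intermediate value theorem would give a common point strictly inside both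
  intervals. As \<open>u\<close> may be a common end, only a weak inequality survives.\<close>

lemma order_preserved:
  assumes e: "continuous_on {fst e..snd e} (F e)" and e': "continuous_on {fst e'..snd e'} (F e')"
    and x: "x \<in> overlap e e'" and u: "u \<in> {fst e..snd e} \<inter> {fst e'..snd e'}"
    and lt: "F e x < F e' x" and nc: "\<not> cross F e e'"
  shows "F e u \<le> F e' u"
proof (rule ccontr)
  assume gt: "\<not> ?thesis"
  define D where "D t = F e' t - F e t" for t
  have c: "continuous_on ({fst e..snd e} \<inter> {fst e'..snd e'}) D" unfolding D_def
    by (intro continuous_intros continuous_on_subset[OF e] continuous_on_subset[OF e']) auto
  have D: "D x > 0" "D u < 0" using lt gt unfolding D_def by auto
  have "\<exists>z\<in>{min u x..max u x}. D z = 0"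
  proof (cases "u \<le> x")
    case True
    have "continuous_on {u..x} D" using x u unfolding overlap_def
      by (intro continuous_on_subset[OF c]) auto
    from IVT'[of D u 0 x, OF _ _ True this] D True show ?thesis by auto
  next
    case False
    have "continuous_on {x..u} D" using x u unfolding overlap_def
      by (intro continuous_on_subset[OF c]) auto
    from IVT2'[of D u 0 x, OF _ _ _ this] D False show ?thesis by auto
  qed
  then obtain z where z: "z \<in> {min u x..max u x}" "D z = 0" by auto
  then have "z \<noteq> u" using D by auto
  then have "z \<in> overlap e e'" using z x u unfolding overlap_def by (auto simp: min_def max_def split: if_splits)
  moreover have "e \<noteq> e'" using lt by auto
  ultimately show False using z(2) nc unfolding cross_def D_def by auto
qed

text \<open>Sort the edges by height over \<open>x\<close>. If two of them share an end
  \<open>v\<close>, an edge between them that extends beyond \<open>v\<close> is squeezed through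
  the vertex \<open>v\<close>, which is forbidden (\<open>pinch\<close>). In an alternation of left
  ends, the one closer to the line gives such a configuration, and likewise on the right. So both
  label sequences are free of alternation.\<close>

lemma card_edges_over_line_le:
  assumes g: "arc_graph \<eta> F V E" and nc: "\<And>e e'. e \<in> E \<Longrightarrow> e' \<in> E \<Longrightarrow> \<not> cross F e e'"
    and over: "\<And>e. e \<in> E \<Longrightarrow> fst e < x \<and> x < snd e"
  shows "card E \<le> 2 * card {v\<in>V. v < x} + 2 * card {v\<in>V. x < v}"
proof -
  have fV: "finite V" and EV: "E \<subseteq> V \<times> V" using g unfolding arc_graph_def by auto
  have cont: "continuous_on {fst e..snd e} (F e)" and l: "F e (fst e) = \<eta> (fst e)"
    and r: "F e (snd e) = \<eta> (snd e)" and av: "v\<in>V \<Longrightarrow> fst e < v \<Longrightarrow> v < snd e \<Longrightarrow> F e v \<noteq> \<eta> v"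
    and inV: "fst e \<in> V" "snd e \<in> V"
    if "e \<in> E" for e v using g that unfolding arc_graph_def by (auto simp: mem_Times_iff)
  have ord: "F e u \<le> F e' u" if "e \<in> E" "e' \<in> E" "F e x < F e' x"
     "u \<in> {fst e..snd e} \<inter> {fst e'..snd e'}" for e e' u
    using order_preserved[of e F e' x u] cont[OF that(1)] cont[OF that(2)] nc[OF that(1,2)]
      over[OF that(1)] over[OF that(2)] that(3,4) unfolding overlap_def by auto
  have pinch: False if "s \<in> E" "t \<in> E" "u \<in> E" "F s x < F t x" "F t x < F u x"
      "v \<in> V" "v = fst s \<and> v = fst u \<or> v = snd s \<and> v = snd u" "fst t < v" "v < snd t" for s t u v
  proof -
    have "F s v = \<eta> v" "F u v = \<eta> v"
      using l[OF that(1)] r[OF that(1)] l[OF that(3)] r[OF that(3)] that(7) by metis+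
    moreover have "F s v \<le> F t v" "F t v \<le> F u v"
      using that over[OF that(1)] over[OF that(2)] over[OF that(3)] by (auto intro!: ord)
    ultimately show False using av[OF that(2,6,8,9)] by auto
  qed
  show ?thesis
  proof (rule card_alternation_free_le[of E _ _ "\<lambda>e. F e x" fst snd])
    show "finite E" using finite_subset[OF EV] fV by auto
    show "inj_on (\<lambda>e. F e x) E"
      using nc over unfolding inj_on_def cross_def overlap_def by fastforce
    show "fst ` E \<subseteq> {v\<in>V. v < x}" "snd ` E \<subseteq> {v\<in>V. x < v}" using inV over by auto
    show "inj_on (\<lambda>e. (fst e, snd e)) E" by (auto simp: inj_on_def)
    fix s t u v assume E: "s \<in> E" "t \<in> E" "u \<in> E" "v \<in> E"
      and lt: "F s x < F t x" "F t x < F u x" "F u x < F v x"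
    show "fst s = fst t" if eq: "fst s = fst u" "fst t = fst v"
    proof (rule ccontr)
      assume "fst s \<noteq> fst t"
      then consider "fst s < fst t" | "fst t < fst s" by linarith
      then show False
      proof cases
        case 1 then show False using pinch[OF E(2,3,4) lt(2,3), of "fst t"] inV E eq over[OF E(2)] over[OF E(3)] by auto
      next
        case 2 then show False using pinch[OF E(1,2,3) lt(1,2), of "fst s"] inV E eq over[OF E(1)] over[OF E(2)] by auto
      qed
    qed
    show "snd s = snd t" if eq: "snd s = snd u" "snd t = snd v"
    proof (rule ccontr)
      assume "snd s \<noteq> snd t"
      then consider "snd s > snd t" | "snd t > snd s" by linarith
      then show False
      proof cases
        case 1 then show False using pinch[OF E(2,3,4) lt(2,3), of "snd t"] inV E eq over[OF E(2)] over[OF E(3)] by auto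
      next
        case 2 then show False using pinch[OF E(1,2,3) lt(1,2), of "snd s"] inV E eq over[OF E(1)] over[OF E(2)] by auto
      qed
    qed
  qed (use fV in auto)
qed

lemma exists_cut:
  fixes V :: "real set"
  assumes "finite V" "m \<le> card V"
  shows "\<exists>t. t \<notin> V \<and> card {v\<in>V. v < t} = m"
  using assms
proof (induction "card V" arbitrary: V m)
  case 0 then show ?case by auto
next
  case (Suc k)
  then have ne: "V \<noteq> {}" by auto
  define w where "w = Max V"
  have w: "w \<in> V" "\<And>v. v \<in> V \<Longrightarrow> v \<le> w" using ne Suc.prems unfolding w_def by auto
  show ?case
  proof (cases "m = card V")
    case True
    have "{v\<in>V. v < w + 1} = V" using w by force
    then show ?thesis using True w by (intro exI[of _ "w+1"]) force
  next
    case False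
    have c: "card (V - {w}) = k" using Suc w by auto
    with Suc.hyps(1)[of "V - {w}" m] Suc False obtain t where
      t: "t \<notin> V - {w}" "card {v\<in>V - {w}. v < t} = m" by auto
    \<comment> \<open>If the cut for the other vertices lies at or above the maximum
      \<open>w\<close>, it is moved between \<open>w\<close> and the next vertex, so that
      \<open>w\<close> is not counted. The element \<open>w - 1\<close> keeps the set under
      \<open>Max\<close> nonempty.\<close>
    define t' where "t' = (if t < w then t else (w + Max (insert (w - 1) (V - {w}))) / 2)"
    let ?M = "Max (insert (w - 1) (V - {w}))"
    have fin: "finite (insert (w - 1) (V - {w}))" using Suc.prems by auto
    have "?M \<in> insert (w - 1) (V - {w})" using fin by (intro Max_in) auto
    then have Mw: "?M < w" using w by fastforce
    have M: "v \<le> ?M" if "v \<in> V" "v \<noteq> w" for v using fin that by (intro Max_ge) auto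
    have t'w: "t' < w" using Mw unfolding t'_def by auto
    have "t' \<notin> V"
      using t(1) Mw M[of t'] t'w unfolding t'_def by (auto split: if_splits)
    moreover have "{v\<in>V. v < t'} = {v\<in>V - {w}. v < t}"
    proof (cases "t < w")
      case True then show ?thesis unfolding t'_def by auto
    next
      case False
      then have "v < t" "v < t'" if "v \<in> V" "v \<noteq> w" for v
        using M[OF that] Mw w(2)[OF that(1)] that(2) unfolding t'_def by auto
      then show ?thesis using t'w by auto
    qed
    ultimately show ?thesis using t(2) by auto
  qed
qed

text \<open>Divide and conquer along a vertical line that halves the vertices. The edges on either
  side are handled recursively, and those over the line number at most twice the vertices. Each of
  the \<open>k\<close> levels thus contributes \<open>2 * card V\<close>.\<close>

lemma card_noncrossing_edges_le:
  assumes "arc_graph \<eta> F V E" "\<And>e e'. e \<in> E \<Longrightarrow> e' \<in> E \<Longrightarrow> \<not> cross F e e'"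
    and "card V \<le> 2 ^ k"
  shows "card E \<le> 2 * k * card V"
  using assms
proof (induction k arbitrary: V E)
  case 0
  have fV: "finite V" using 0 unfolding arc_graph_def by auto
  have "E = {}"
  proof (rule ccontr)
    assume "E \<noteq> {}"
    then obtain e where "e \<in> E" by auto
    then have "fst e \<in> V" "snd e \<in> V" "fst e \<noteq> snd e"
      using 0(1) unfolding arc_graph_def by (auto simp: mem_Times_iff)
    then show False using 0(3) fV by (metis One_nat_def card_le_Suc0_iff_eq power_0)
  qed
  then show ?case by simp
next
  case (Suc k)
  have fV: "finite V" and EV: "E \<subseteq> V \<times> V" and lt: "\<And>e. e \<in> E \<Longrightarrow> fst e < snd e"
    using Suc(2) unfolding arc_graph_def by auto
  have fE: "finite E" using finite_subset[OF EV] fV by auto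
  obtain x where x: "x \<notin> V" "card {v\<in>V. v < x} = card V div 2"
    using exists_cut[OF fV, of "card V div 2"] by auto
  let ?L = "{v\<in>V. v < x}" and ?R = "{v\<in>V. x < v}"
  have V: "card V = card ?L + card ?R"
  proof -
    have "v < x \<or> x < v" if "v \<in> V" for v using x(1) that by (metis linorder_neqE_linordered_idom)
    then have "V = ?L \<union> ?R" by auto
    then have "card V = card (?L \<union> ?R)" by (rule arg_cong)
    also have "\<dots> = card ?L + card ?R" using fV by (intro card_Un_disjoint) auto
    finally show ?thesis .
  qed
  let ?EL = "{e\<in>E. snd e < x}" and ?ER = "{e\<in>E. x < fst e}" and ?EX = "{e\<in>E. fst e < x \<and> x < snd e}"
  have half: "card ?L \<le> 2 ^ k" "card ?R \<le> 2 ^ k" using x(2) V Suc.prems(3) by simp_all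
  have "card ?EL \<le> 2 * k * card ?L"
  proof (rule Suc.IH[OF arc_graph_subset[OF Suc.prems(1)]])
    show "?EL \<subseteq> ?L \<times> ?L" using EV lt by (force simp: mem_Times_iff)
  qed (use Suc.prems(2) half in auto)
  moreover have "card ?ER \<le> 2 * k * card ?R"
  proof (rule Suc.IH[OF arc_graph_subset[OF Suc.prems(1)]])
    show "?ER \<subseteq> ?R \<times> ?R" using EV lt by (force simp: mem_Times_iff)
  qed (use Suc.prems(2) half in auto)
  moreover have "card ?EX \<le> 2 * card ?L + 2 * card ?R"
    using Suc.prems EV
    by (intro card_edges_over_line_le[where F = F and \<eta> = \<eta>] arc_graph_subset[OF Suc.prems(1)]) auto
  moreover have "E = ?EL \<union> ?ER \<union> ?EX" 
  proof -
    have "fst e \<noteq> x" "snd e \<noteq> x" if "e \<in> E" for e using EV x that by auto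
    then show ?thesis by (force simp: not_less)
  qed
  then have "card E = card (?EL \<union> ?ER \<union> ?EX)" by (rule arg_cong)
  moreover have "\<dots> \<le> card ?EL + card ?ER + card ?EX"
    using card_Un_le[of "?EL \<union> ?ER" ?EX] card_Un_le[of ?EL ?ER] by linarith
  ultimately have "card E \<le> 2 * k * card ?L + 2 * k * card ?R + 2 * card ?L + 2 * card ?R" by linarith
  also have "\<dots> = 2 * Suc k * card V" unfolding V by (simp add: algebra_simps)
  finally show ?case .
qed

section \<open>The crossing lemma\<close>

lemma card_colourings_fixed:
  fixes q :: nat
  assumes "finite V" "T \<subseteq> V" "q > 0"
  shows "card {f \<in> V \<rightarrow>\<^sub>E {..<q}. \<forall>t\<in>T. f t = 0} * q ^ card T = q ^ card V"
proof -
  have "{f \<in> V \<rightarrow>\<^sub>E {..<q}. \<forall>t\<in>T. f t = 0} = (\<Pi>\<^sub>E v\<in>V. if v \<in> T then {0} else {..<q})"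
    (is "?A = ?B")
  proof
    show "?A \<subseteq> ?B" by (auto simp: PiE_iff extensional_def)
    show "?B \<subseteq> ?A"
    proof
      fix f assume f: "f \<in> ?B"
      then have "f v = 0" if "v \<in> T" for v using PiE_mem[OF f, of v] that assms(2) by auto
      moreover have "f v \<in> {..<q}" if "v \<in> V" for v
        using PiE_mem[OF f that] assms(3) by (auto split: if_splits)
      ultimately show "f \<in> ?A" using f by (auto simp: PiE_iff)
    qed
  qed
  then have "card {f \<in> V \<rightarrow>\<^sub>E {..<q}. \<forall>t\<in>T. f t = 0} = (\<Prod>v\<in>V. if v \<in> T then 1 else q)"
    using assms(1) by (simp add: card_PiE if_distrib cong: if_cong)
  also have "\<dots> = q ^ card (V - T)"
    using assms(1) by (simp add: prod.If_cases Diff_eq Compl_eq)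
  finally show ?thesis
    using assms by (simp add: power_add[symmetric] card_Diff_subset finite_subset card_mono)
qed

text \<open>An expectation written without division: under a uniform colouring with \<open>q\<close>
  colours, a support of \<open>m\<close> vertices receives only colour 0 with probability
  \<open>1 / q ^ m\<close>. The proof is a double count.\<close>

lemma sum_colourings_card:
  fixes q :: nat and supp :: "'b \<Rightarrow> 'a set"
  assumes V: "finite V" and q: "q > 0" and A: "finite A"
    and T: "\<And>a. a \<in> A \<Longrightarrow> supp a \<subseteq> V \<and> card (supp a) = m"
  shows "(\<Sum>f\<in>V \<rightarrow>\<^sub>E {..<q}. card {a\<in>A. \<forall>t\<in>supp a. f t = 0}) * q ^ m = card A * q ^ card V"
proof -
  have fin: "finite (V \<rightarrow>\<^sub>E {..<q})" using V by (simp add: finite_PiE)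
  have "(\<Sum>f\<in>V \<rightarrow>\<^sub>E {..<q}. card {a\<in>A. \<forall>t\<in>supp a. f t = 0})
      = (\<Sum>f\<in>V \<rightarrow>\<^sub>E {..<q}. \<Sum>a\<in>A. if \<forall>t\<in>supp a. f t = 0 then 1 else 0)"
    using A by (simp only: card_eq_sum sum.inter_filter)
  also have "\<dots> = (\<Sum>a\<in>A. \<Sum>f\<in>V \<rightarrow>\<^sub>E {..<q}. if \<forall>t\<in>supp a. f t = 0 then 1 else 0)"
    by (rule sum.swap)
  also have "\<dots> = (\<Sum>a\<in>A. card {f \<in> V \<rightarrow>\<^sub>E {..<q}. \<forall>t\<in>supp a. f t = 0})"
    using fin by (simp only: card_eq_sum sum.inter_filter)
  also have "\<dots> * q ^ m = (\<Sum>a\<in>A. q ^ card V)"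
    unfolding sum_distrib_right
  proof (rule sum.cong)
    fix a assume "a \<in> A"
    then show "card {f \<in> V \<rightarrow>\<^sub>E {..<q}. \<forall>t\<in>supp a. f t = 0} * q ^ m = q ^ card V"
      using card_colourings_fixed[OF V _ q, of "supp a"] T[of a] by simp
  qed simp
  finally show ?thesis by simp
qed

text \<open>Average the bound for planar subgraphs over the subgraphs induced by
  a random vertex set which contains each vertex with probability \<open>1/q\<close>.\<close>

lemma crossing_inequality:
  assumes g: "arc_graph \<eta> F V E" and k: "card V \<le> 2 ^ k" and q: "q > 0"
    and four: "\<And>e e'. e \<in> E \<Longrightarrow> e' \<in> E \<Longrightarrow> cross F e e' \<Longrightarrow> card {fst e, snd e, fst e', snd e'} = 4"
  shows "card E * q ^ 2 \<le> card {(e, e') \<in> E \<times> E. cross F e e'} + 2 * k * card V * q ^ 3"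
proof -
  have fV: "finite V" and EV: "E \<subseteq> V \<times> V" and lt: "\<And>e. e \<in> E \<Longrightarrow> fst e < snd e"
    using g unfolding arc_graph_def by auto
  have fE: "finite E" using finite_subset[OF EV] fV by auto
  define X where "X = {(e, e') \<in> E \<times> E. cross F e e'}"
  have fX: "finite X" unfolding X_def by (rule finite_subset[of _ "E \<times> E"]) (use fE in auto)
  define s2 where "s2 e = {fst e, snd e}" for e :: "real \<times> real"
  define s4 where "s4 p = s2 (fst p) \<union> s2 (snd p)" for p :: "(real \<times> real) \<times> (real \<times> real)"
  define Ef Xf Vf where "Ef f = {e\<in>E. \<forall>t\<in>s2 e. f t = 0}" and "Xf f = {p\<in>X. \<forall>t\<in>s4 p. f t = 0}"
    and "Vf f = {v\<in>V. \<forall>t\<in>{v}. f t = 0}" for f :: "real \<Rightarrow> nat"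
  let ?C = "V \<rightarrow>\<^sub>E {..<q}"
  have pw: "card (Ef f) \<le> card (Xf f) + 2 * k * card (Vf f)" for f
  proof -
    \<comment> \<open>Deleting the first edge of every surviving crossing pair leaves a drawing
      without crossings.\<close>
    define D where "D = Ef f - fst ` Xf f"
    have "card D \<le> 2 * k * card (Vf f)"
    proof (rule card_noncrossing_edges_le)
      show "arc_graph \<eta> F (Vf f) D" using EV
        by (intro arc_graph_subset[OF g]) (auto simp: D_def Ef_def Vf_def s2_def)
      have "card (Vf f) \<le> card V" using fV by (intro card_mono) (auto simp: Vf_def)
      then show "card (Vf f) \<le> 2 ^ k" using k by simp
      show "\<not> cross F e e'" if "e \<in> D" "e' \<in> D" for e e'
      proof
        assume "cross F e e'"
        then have "(e, e') \<in> Xf f" using that by (auto simp: D_def Ef_def Xf_def X_def s4_def)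
        then have "e \<in> fst ` Xf f" by force
        then show False using that unfolding D_def by auto
      qed
    qed
    moreover have "card (Ef f) - card (fst ` Xf f) \<le> card D" unfolding D_def
      using fX by (intro diff_card_le_card_Diff) (auto simp: Xf_def)
    moreover have "card (fst ` Xf f) \<le> card (Xf f)"
      using fX by (intro card_image_le) (auto simp: Xf_def)
    ultimately show ?thesis by linarith
  qed
  have "(\<Sum>f\<in>?C. card (Ef f)) * q ^ 2 = card E * q ^ card V"
    unfolding Ef_def
  proof (rule sum_colourings_card[OF fV q fE])
    fix e assume "e \<in> E" then show "s2 e \<subseteq> V \<and> card (s2 e) = 2"
      using EV lt[of e] unfolding s2_def by (auto simp: mem_Times_iff)
  qed
  moreover have "(\<Sum>f\<in>?C. card (Xf f)) * q ^ 4 = card X * q ^ card V"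
    unfolding Xf_def
  proof (rule sum_colourings_card[OF fV q fX])
    fix p assume "p \<in> X"
    moreover have "s4 p = {fst (fst p), snd (fst p), fst (snd p), snd (snd p)}"
      unfolding s4_def s2_def by auto
    ultimately show "s4 p \<subseteq> V \<and> card (s4 p) = 4"
      using EV four[of "fst p" "snd p"] unfolding X_def by auto
  qed
  moreover have "(\<Sum>f\<in>?C. card (Vf f)) * q ^ 1 = card V * q ^ card V"
    unfolding Vf_def by (rule sum_colourings_card[OF fV q fV]) auto
  moreover have "(\<Sum>f\<in>?C. card (Ef f)) * q ^ 4 \<le> ((\<Sum>f\<in>?C. card (Xf f)) + 2 * k * (\<Sum>f\<in>?C. card (Vf f))) * q ^ 4"
    unfolding sum_distrib_left sum.distrib[symmetric] by (intro mult_right_mono sum_mono pw) auto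
  \<comment> \<open>Edges, crossings and vertices have supports of size 2, 4 and 1; after
    multiplication by \<open>q ^ 4\<close> they keep the factors \<open>q ^ 2\<close>, 1 and
    \<open>q ^ 3\<close>.\<close>
  ultimately have "card E * q ^ 2 * q ^ card V \<le> (card X + 2 * k * card V * q ^ 3) * q ^ card V"
    by (auto simp: algebra_simps eval_nat_numeral)
  then show ?thesis using q unfolding X_def by simp
qed

text \<open>Unless the linear term already suffices, choose \<open>q\<close> so that the vertex term
  of \<open>crossing_inequality\<close> is at most half of \<open>card E * q ^ 2\<close>. Then the
  crossings account for the other half, and solving for \<open>card E\<close> gives the exponent
  2/3. The number of crossing pairs is bounded by a square because it will be the number of pairs of
  circles.\<close>

lemma crossing_lemma:
  assumes g: "arc_graph \<eta> F V E" and k: "card V \<le> 2 ^ k" "k > 0"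
    and four: "\<And>e e'. e \<in> E \<Longrightarrow> e' \<in> E \<Longrightarrow> cross F e e' \<Longrightarrow> card {fst e, snd e, fst e', snd e'} = 4"
    and X: "card {(e, e') \<in> E \<times> E. cross F e e'} \<le> a ^ 2"
  shows "real (card E) \<le> 6 * real k * (real a * real (card V)) powr (2/3) + 4 * real k * real (card V)"
proof (cases "card E < 4 * k * card V \<or> card E = 0")
  case True
  have "real (card E) \<le> 4 * real k * real (card V)"
  proof -
    have "card E \<le> 4 * k * card V" using True by auto
    then have "real (card E) \<le> real (4 * k * card V)" by (simp only: of_nat_le_iff)
    then show ?thesis by simp
  qed
  then show ?thesis by (simp add: add_increasing)
next
  case False
  define e v b where "e = real (card E)" and "v = real k * real (card V)" and "b = real a"
  have "card V \<noteq> 0"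
    using False g unfolding arc_graph_def by (auto simp: card_eq_0_iff)
  then have v: "v > 0" unfolding v_def using k by auto
  have "4 * (k * card V) \<le> card E" using False by auto
  then have e4: "4 * v \<le> e" unfolding e_def v_def
    by (metis (no_types, opaque_lifting) of_nat_le_iff of_nat_mult of_nat_numeral)
  \<comment> \<open>With \<open>q\<close> at most \<open>e / (4 * v)\<close> the term
    \<open>2 * v * q ^ 3\<close> is at most \<open>e / 2 * q ^ 2\<close>. Rounding down loses at
    most a factor 2, since \<open>e / (4 * v)\<close> is at least 1.\<close>
  define q where "q = nat \<lfloor>e / (4 * v)\<rfloor>"
  have r: "e / (4 * v) \<ge> 1" using e4 v by (simp add: field_simps)
  have qr: "real q \<le> e / (4 * v)" "e / (8 * v) \<le> real q" and q: "q > 0"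
  proof -
    show "q > 0" using r unfolding q_def by simp
    show "real q \<le> e / (4 * v)" using r unfolding q_def by simp
    have "t / 2 \<le> real (nat \<lfloor>t\<rfloor>)" if "t \<ge> 1" for t :: real
    proof -
      have "\<lfloor>t\<rfloor> \<ge> 1" using that by simp
      then have "real (nat \<lfloor>t\<rfloor>) = of_int \<lfloor>t\<rfloor>" "of_int \<lfloor>t\<rfloor> \<ge> (1::real)" by simp_all
      then show ?thesis by linarith
    qed
    from this[OF r] have "e / (4 * v) / 2 \<le> real q" unfolding q_def .
    then show "e / (8 * v) \<le> real q" by simp
  qed
  have "card E * q ^ 2 \<le> card {(e, e') \<in> E \<times> E. cross F e e'} + 2 * k * card V * q ^ 3"
    by (rule crossing_inequality[OF g k(1) q]) (rule four)
  then have "card E * q ^ 2 \<le> a ^ 2 + 2 * k * card V * q ^ 3" using X by linarith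
  then have "real (card E * q ^ 2) \<le> real (a ^ 2 + 2 * k * card V * q ^ 3)"
    by (simp only: of_nat_le_iff)
  then have 1: "e * real q ^ 2 \<le> b ^ 2 + 2 * v * real q ^ 3"
    unfolding e_def v_def b_def by (simp add: algebra_simps)
  have "2 * v * real q ^ 3 = 2 * v * real q * real q ^ 2" by (simp add: power2_eq_square power3_eq_cube)
  also have "\<dots> \<le> e / 2 * real q ^ 2"
    using qr(1) v by (intro mult_right_mono) (auto simp: field_simps)
  finally have "e * real q ^ 2 \<le> 2 * b ^ 2" using 1 by simp
  moreover have "e * (e / (8 * v)) ^ 2 \<le> e * real q ^ 2"
    using qr(2) e4 v by (intro mult_left_mono power_mono) auto
  ultimately have "e * (e / (8 * v)) ^ 2 \<le> 2 * b ^ 2" by linarith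
  then have "e ^ 3 \<le> 128 * (b * v) ^ 2" using v
    by (simp add: field_simps power2_eq_square power3_eq_cube)
  \<comment> \<open>The constant is raised to the cube of 6 so that the cube root is clean.\<close>
  also have "\<dots> \<le> 216 * (b * v) ^ 2" by simp
  finally have "e powr 3 \<le> 6 powr 3 * (b * v) powr 2"
    using v e4 unfolding b_def by (cases "a = 0") (auto simp: powr_numeral)
  then have "(e powr 3) powr (1/3) \<le> (6 powr 3 * (b * v) powr 2) powr (1/3)"
    by (intro powr_mono2) auto
  moreover have "(e powr 3) powr (1/3) = e" unfolding powr_powr using e4 v by simp
  moreover have "(6 powr 3 * (b * v) powr 2) powr (1/3) = 6 * (b * v) powr (2/3)"
    unfolding powr_mult powr_powr by simp
  ultimately have "e \<le> 6 * (b * v) powr (2/3)" by simp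
  moreover have "(b * v) powr (2/3) = real k powr (2/3) * (b * real (card V)) powr (2/3)"
    unfolding v_def b_def by (simp add: powr_mult)
  moreover have "real k powr (2/3) * (b * real (card V)) powr (2/3) \<le> real k * (b * real (card V)) powr (2/3)"
    using k powr_mono[of "2/3" 1 "real k"] by (intro mult_right_mono) auto
  moreover have "0 \<le> 4 * real k * real (card V)" by simp
  ultimately show ?thesis unfolding e_def b_def by linarith
qed

section \<open>Incidences with circles of equal radius\<close>

definition upper :: "real \<Rightarrow> real \<times> real \<Rightarrow> real \<times> real \<Rightarrow> bool" where
  "upper d c p \<longleftrightarrow> dist c p = d \<and> snd c \<le> snd p"

text \<open>This is a total, everywhere continuous function, but it describes the half circle only
  for abscissae within \<open>d\<close> of the centre; equalities between values are exploited only
  there.\<close>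

definition half_circle :: "real \<Rightarrow> real \<times> real \<Rightarrow> real \<Rightarrow> real" where
  "half_circle d c x = snd c + sqrt (d\<^sup>2 - (x - fst c)\<^sup>2)"

lemma dist_sq: "(dist c p)\<^sup>2 = (fst p - fst c)\<^sup>2 + (snd p - snd c)\<^sup>2" for c p :: "real \<times> real"
  by (simp add: dist_prod_def dist_real_def power2_commute)

lemma upper_iff:
  assumes "d > 0"
  shows "upper d c p \<longleftrightarrow> \<bar>fst p - fst c\<bar> \<le> d \<and> snd p = half_circle d c (fst p)"
proof
  assume u: "upper d c p"
  have eq: "(fst p - fst c)\<^sup>2 + (snd p - snd c)\<^sup>2 = d\<^sup>2" and le: "snd c \<le> snd p"
    using u dist_sq[of c p] unfolding upper_def by auto
  have "(fst p - fst c)\<^sup>2 \<le> d\<^sup>2" using eq by (smt (verit) zero_le_power2)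
  then have "\<bar>fst p - fst c\<bar> \<le> d" using assms abs_le_square_iff[of "fst p - fst c" d] by auto
  moreover have "sqrt (d\<^sup>2 - (fst p - fst c)\<^sup>2) = snd p - snd c"
    using eq le by (intro real_sqrt_unique) auto
  ultimately show "\<bar>fst p - fst c\<bar> \<le> d \<and> snd p = half_circle d c (fst p)"
    unfolding half_circle_def by auto
next
  assume a: "\<bar>fst p - fst c\<bar> \<le> d \<and> snd p = half_circle d c (fst p)"
  then have le: "(fst p - fst c)\<^sup>2 \<le> d\<^sup>2" using assms abs_le_square_iff[of "fst p - fst c" d] by auto
  then have "(snd p - snd c)\<^sup>2 = d\<^sup>2 - (fst p - fst c)\<^sup>2" "snd c \<le> snd p"
    using a unfolding half_circle_def by auto
  then show "upper d c p" using dist_sq[of c p] assms unfolding upper_def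
    by (simp add: power2_eq_iff_nonneg)
qed

lemma continuous_on_half_circle [continuous_intros]: "continuous_on S (half_circle d c)"
  unfolding half_circle_def by (intro continuous_intros)

text \<open>Two distinct circles of the same radius through \<open>p\<close> and \<open>q\<close> have centres symmetric about the
  midpoint of \<open>p\<close> and \<open>q\<close>, so \<open>p\<close> and \<open>q\<close> cannot both lie on the upper halves of both circles.\<close>

lemma upper_unique:
  assumes d: "d > 0" and u: "upper d c p" "upper d c q" "upper d c' p" "upper d c' q" and "p \<noteq> q"
  shows "c = c'"
proof (rule ccontr)
  assume "c \<noteq> c'"
  obtain u1 u2 v1 v2 w1 w2 where
    uvw: "u1 = fst p - fst c" "u2 = snd p - snd c" "v1 = fst q - fst c" "v2 = snd q - snd c"
      "w1 = fst c - fst c'" "w2 = snd c - snd c'" by blast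
  have w: "w1 \<noteq> 0 \<or> w2 \<noteq> 0" using \<open>c \<noteq> c'\<close> uvw by (auto simp: prod_eq_iff)
  have s: "u1\<^sup>2 + u2\<^sup>2 = d\<^sup>2" "v1\<^sup>2 + v2\<^sup>2 = d\<^sup>2" "(u1 + w1)\<^sup>2 + (u2 + w2)\<^sup>2 = d\<^sup>2" "(v1 + w1)\<^sup>2 + (v2 + w2)\<^sup>2 = d\<^sup>2"
    using u dist_sq[of c p] dist_sq[of c q] dist_sq[of c' p] dist_sq[of c' q] uvw
    unfolding upper_def by auto
  have n: "u2 \<ge> 0" "v2 \<ge> 0" "u2 + w2 \<ge> 0" "v2 + w2 \<ge> 0"
    using u uvw unfolding upper_def by auto
  have uv: "u1 \<noteq> v1 \<or> u2 \<noteq> v2" using \<open>p \<noteq> q\<close> uvw by (auto simp: prod_eq_iff)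
  \<comment> \<open>\<open>z\<close> is p + q - c - c', twice the difference of the midpoints of the
    two chords. Both \<open>z\<close> and p - q are orthogonal to the nonzero \<open>w\<close>,
    hence parallel to each other; they are also orthogonal to each other, and p and q differ, so
    \<open>z\<close> vanishes. Then \<open>z2 = 0\<close> is a sum of the nonnegative heights
    \<open>u2\<close> and \<open>v2 + w2\<close>, which puts p and q at opposite ends of one
    horizontal diameter and forces c = c'.\<close>
  obtain z1 z2 where z: "z1 = u1 + v1 + w1" "z2 = u2 + v2 + w2" by blast
  have e1: "(u1 - v1) * w1 + (u2 - v2) * w2 = 0" and e2: "z1 * w1 + z2 * w2 = 0"
    and e3: "(u1 - v1) * z1 + (u2 - v2) * z2 = 0"
    using s z by (algebra)+
  have "w1 * ((u1 - v1) * z2 - (u2 - v2) * z1) = 0" "w2 * ((u1 - v1) * z2 - (u2 - v2) * z1) = 0"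
    using e1 e2 by algebra+
  then have e4: "(u1 - v1) * z2 - (u2 - v2) * z1 = 0" using w by auto
  have "((u1 - v1)\<^sup>2 + (u2 - v2)\<^sup>2) * (z1\<^sup>2 + z2\<^sup>2) = 0" using e3 e4 by algebra
  then have "z1 = 0 \<and> z2 = 0" using uv by (auto simp: sum_power2_eq_zero_iff)
  then have "u2 = 0" "v2 = 0" "w2 = 0" using n z by auto
  with s have "u1 = d \<or> u1 = - d" "v1 = d \<or> v1 = - d" by (auto simp: power2_eq_iff)
  then show False using uv \<open>z1 = 0 \<and> z2 = 0\<close> z w \<open>u2 = 0\<close> \<open>v2 = 0\<close> \<open>w2 = 0\<close> by auto
qed

lemma half_circle_unique:
  assumes "d > 0" "\<bar>x - fst c\<bar> \<le> d" "\<bar>y - fst c\<bar> \<le> d" "\<bar>x - fst c'\<bar> \<le> d" "\<bar>y - fst c'\<bar> \<le> d"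
    and "half_circle d c x = half_circle d c' x" "half_circle d c y = half_circle d c' y" "x \<noteq> y"
  shows "c = c'"
  using assms by (intro upper_unique[of d c "(x, half_circle d c x)" "(y, half_circle d c y)"])
    (auto simp: upper_iff)

section \<open>Counting incidences by drawing circles as graphs\<close>

definition incidences :: "real \<Rightarrow> (real \<times> real) set \<Rightarrow> (real \<times> real) set \<Rightarrow> ((real \<times> real) \<times> (real \<times> real)) set" where
  "incidences d A B = {(c, p) \<in> A \<times> B. dist c p = d}"

definition upper_inc :: "real \<Rightarrow> (real \<times> real) set \<Rightarrow> (real \<times> real) set \<Rightarrow> ((real \<times> real) \<times> (real \<times> real)) set" where
  "upper_inc d A B = {(c, p) \<in> A \<times> B. upper d c p}"

text \<open>The drawing has the points of \<open>B\<close> as vertices and, as edges, the pieces of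
  upper half circles between consecutive points on them. Two half circles meet at most once, so
  there are at most \<open>(card A)\<^sup>2\<close> ordered crossing pairs. Every incidence except
  the last one on its half circle starts an edge, so the crossing lemma bounds the
  incidences.\<close>

lemma card_upper_inc_le_generic:
  assumes d: "d > 0" and fA: "finite A" and fB: "finite B" and inj: "inj_on fst B"
    and k: "card B \<le> 2 ^ k" "k > 0"
  shows "real (card (upper_inc d A B)) \<le>
    6 * real k * ((real (card A) * real (card B)) powr (2/3) + real (card A) + real (card B))"
proof -
  define V where "V = fst ` B"
  define \<eta> where "\<eta> x = snd (the_inv_into B fst x)" for x
  have V: "finite V" "card V = card B" unfolding V_def using fB inj by (auto simp: card_image)
  have \<eta>: "\<eta> (fst p) = snd p" if "p \<in> B" for p
    unfolding \<eta>_def using the_inv_into_f_f[OF inj that] by simp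
  define on where "on c v \<longleftrightarrow> c \<in> A \<and> v \<in> V \<and> \<bar>v - fst c\<bar> \<le> d \<and> \<eta> v = half_circle d c v" for c v
  define edge where "edge c e \<longleftrightarrow> on c (fst e) \<and> on c (snd e) \<and> fst e < snd e \<and>
      (\<forall>v. fst e < v \<and> v < snd e \<longrightarrow> \<not> on c v)" for c e
  define E where "E = {e. \<exists>c. edge c e}"
  define ctr where "ctr e = (SOME c. edge c e)" for e
  define F where "F e = half_circle d (ctr e)" for e
  have ctr: "edge (ctr e) e" if "e \<in> E" for e
    using that unfolding E_def ctr_def by (auto intro: someI)
  have on_eq: "c = c'" if "on c v" "on c w" "on c' v" "on c' w" "v \<noteq> w" for c c' v w
    using half_circle_unique[OF d, of v c w c'] that unfolding on_def by auto
  \<comment> \<open>Two points determine the half circle through them, so no two half circles yield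
    the same edge and the choice made in \<open>ctr\<close> is immaterial.\<close>
  have ctr_eq: "ctr e = c" if "edge c e" for c e
  proof -
    have "edge (ctr e) e" using ctr that unfolding E_def by blast
    then show ?thesis using that on_eq[of "ctr e" "fst e" "snd e" c] less_imp_neq unfolding edge_def by blast
  qed
  have in_range: "\<bar>x - fst c\<bar> \<le> d" if "edge c e" "x \<in> {fst e..snd e}" for c e x
    using that unfolding edge_def on_def by auto
  have EV: "E \<subseteq> V \<times> V" unfolding E_def edge_def on_def by (auto simp: mem_Times_iff)
  have fE: "finite E" using finite_subset[OF EV] V by auto
  have graph: "arc_graph \<eta> F V E"
    unfolding arc_graph_def
  proof (intro conjI ballI allI impI V EV)
    fix e assume e: "e \<in> E"
    note ce = ctr[OF e]
    show "fst e < snd e" "F e (fst e) = \<eta> (fst e)" "F e (snd e) = \<eta> (snd e)"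
      using ce unfolding edge_def on_def F_def by auto
    show "continuous_on {fst e..snd e} (F e)" unfolding F_def by (rule continuous_on_half_circle)
    show "F e v \<noteq> \<eta> v" if "v \<in> V" "fst e < v \<and> v < snd e" for v
      using ce in_range[OF ce, of v] that unfolding edge_def on_def F_def by auto
  qed
  \<comment> \<open>Arcs that agree at two abscissae lie on one half circle, where overlapping
    pieces coincide. Hence arcs with a common end never cross.\<close>
  have meet: "ctr e = ctr e' \<and> e = e'" if e: "e \<in> E" "e' \<in> E" and v: "v \<in> {fst e..snd e} \<inter> {fst e'..snd e'}"
    and x: "x \<in> overlap e e'" and "v \<noteq> x" "F e x = F e' x" "F e v = F e' v" for e e' v x
  proof
    note r = in_range[OF ctr[OF e(1)]] in_range[OF ctr[OF e(2)]]
    show c: "ctr e = ctr e'"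
      using that r unfolding F_def overlap_def by (intro half_circle_unique[OF d, of v _ x]) auto
    have "edge (ctr e) e" "edge (ctr e) e'" using ctr e c by metis+
    then have "fst e = fst e'" "snd e = snd e'" using x unfolding edge_def overlap_def
      by (smt (verit) IntE greaterThanLessThan_iff)+
    then show "e = e'" by (simp add: prod_eq_iff)
  qed
  have same: "e = e'" if "edge c e" "edge c e'" "x \<in> overlap e e'" for c e e' x
  proof -
    have "fst e = fst e'" "snd e = snd e'" using that unfolding edge_def overlap_def
      by (smt (verit) IntE greaterThanLessThan_iff)+
    then show "e = e'" by (simp add: prod_eq_iff)
  qed
  have E_bound: "real (card E) \<le> 6 * real k * (real (card A) * real (card V)) powr (2/3) + 4 * real k * real (card V)"
  proof (rule crossing_lemma[OF graph])
    show "card V \<le> 2 ^ k" "0 < k" using k V by auto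
    show "card {fst e, snd e, fst e', snd e'} = 4" if "e \<in> E" "e' \<in> E" and cr: "cross F e e'" for e e'
    proof -
      obtain x where x: "e \<noteq> e'" "x \<in> overlap e e'" "F e x = F e' x" using cr unfolding cross_def by auto
      have g: "F e (fst e) = \<eta> (fst e)" "F e (snd e) = \<eta> (snd e)" if "e \<in> E" for e
        using graph that unfolding arc_graph_def by auto
      \<comment> \<open>Left ends lie before the crossing and right ends after it, so only a common
        left end or a common right end has to be excluded.\<close>
      have lt: "fst e < x" "x < snd e" "fst e' < x" "x < snd e'" using x(2) unfolding overlap_def by auto
      have "fst e \<noteq> fst e'"
      proof
        assume eq: "fst e = fst e'"
        have "F e (fst e) = F e' (fst e)" using g[OF that(1)] g[OF that(2)] eq by metis
        then show False
          using meet[OF that(1,2) _ x(2) _ x(3), of "fst e"] x(1) lt eq by auto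
      qed
      moreover have "snd e \<noteq> snd e'"
      proof
        assume eq: "snd e = snd e'"
        have "F e (snd e) = F e' (snd e)" using g[OF that(1)] g[OF that(2)] eq by metis
        then show False
          using meet[OF that(1,2) _ x(2) _ x(3), of "snd e"] x(1) lt eq by auto
      qed
      ultimately show ?thesis using lt by auto
    qed
    let ?X = "{(e, e') \<in> E \<times> E. cross F e e'}"
    \<comment> \<open>The two centres determine the crossing point, and the arc of a given half
      circle over a given abscissa interior to it is unique. So the centres determine both
      edges.\<close>
    have "inj_on (\<lambda>(e, e'). (ctr e, ctr e')) ?X"
    proof (rule inj_onI, clarify)
      fix a b a' b' f g f' g' :: real
      let ?e = "(a, b)" and ?e' = "(a', b')" and ?f = "(f, g)" and ?f' = "(f', g')"
      assume E: "?e \<in> E" "?e' \<in> E" "?f \<in> E" "?f' \<in> E"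
        and cr: "cross F ?e ?e'" "cross F ?f ?f'" and c: "ctr ?e = ctr ?f" "ctr ?e' = ctr ?f'"
      obtain x where x: "?e \<noteq> ?e'" "x \<in> overlap ?e ?e'" "F ?e x = F ?e' x" using cr(1) unfolding cross_def by auto
      obtain y where y: "?f \<noteq> ?f'" "y \<in> overlap ?f ?f'" "F ?f y = F ?f' y" using cr(2) unfolding cross_def by auto
      have ne: "ctr ?e \<noteq> ctr ?e'"
        using same[of "ctr ?e" ?e ?e' x] ctr[OF E(1)] ctr[OF E(2)] x by auto
      have "x = y"
      proof (rule ccontr)
        assume "x \<noteq> y"
        moreover have "\<bar>x - fst (ctr ?e)\<bar> \<le> d" "\<bar>x - fst (ctr ?e')\<bar> \<le> d"
          "\<bar>y - fst (ctr ?e)\<bar> \<le> d" "\<bar>y - fst (ctr ?e')\<bar> \<le> d"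
          using in_range[OF ctr[OF E(1)], of x] in_range[OF ctr[OF E(2)], of x]
            in_range[OF ctr[OF E(3)], of y] in_range[OF ctr[OF E(4)], of y] x(2) y(2) c
          unfolding overlap_def by auto
        ultimately have "ctr ?e = ctr ?e'"
          using x(3) y(3) c unfolding F_def by (intro half_circle_unique[OF d, of x _ y]) auto
        with ne show False by simp
      qed
      then have "x \<in> overlap ?e ?f" "x \<in> overlap ?e' ?f'" using x(2) y(2) unfolding overlap_def by auto
      then have "?e = ?f" "?e' = ?f'"
        using same[of "ctr ?e" ?e ?f x] same[of "ctr ?e'" ?e' ?f' x] ctr[OF E(1)] ctr[OF E(2)] ctr[OF E(3)] ctr[OF E(4)] c
        by auto
      then show "((a, b) = (f, g)) \<and> (a', b') = (f', g')" by simp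
    qed
    moreover have "(\<lambda>(e, e'). (ctr e, ctr e')) ` ?X \<subseteq> A \<times> A"
      using ctr unfolding edge_def on_def by fastforce
    ultimately have "card ?X \<le> card (A \<times> A)" using fA by (intro card_inj_on_le) auto
    then show "card ?X \<le> (card A)\<^sup>2" by (simp add: power2_eq_square card_cartesian_product)
  qed
  let ?I = "upper_inc d A B"
  have fI: "finite ?I" unfolding upper_inc_def using fA fB by (auto intro: finite_subset[of _ "A \<times> B"])
  have I_on: "on c (fst p)" if "(c, p) \<in> ?I" for c p
    using that \<eta> upper_iff[OF d, of c p] unfolding upper_inc_def on_def V_def by auto
  define L where "L = {(c, p) \<in> ?I. \<forall>v. on c v \<longrightarrow> v \<le> fst p}"
  have "card L \<le> card A"
  proof (rule card_inj_on_le[of fst])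
    show "inj_on fst L"
    proof (rule inj_onI)
      fix i j assume i: "i \<in> L" and j: "j \<in> L" and eq: "fst i = fst j"
      have I: "(fst i, snd i) \<in> ?I" "(fst i, snd j) \<in> ?I" using i j eq unfolding L_def by auto
      have "fst (snd i) \<le> fst (snd j)" "fst (snd j) \<le> fst (snd i)"
        using i j eq I_on[OF I(1)] I_on[OF I(2)] unfolding L_def by auto
      then have "snd i = snd j"
        using I by (intro inj_onD[OF inj]) (auto simp: upper_inc_def)
      then show "i = j" using eq by (simp add: prod_eq_iff)
    qed
  qed (use fA in \<open>auto simp: L_def upper_inc_def\<close>)
  moreover have "card (?I - L) \<le> card E"
  proof -
    have ex: "\<exists>w. edge c (fst p, w)" if "(c, p) \<in> ?I - L" for c p
    proof -
      let ?W = "{w. on c w \<and> fst p < w}"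
      have "finite ?W" by (rule finite_subset[OF _ V(1)]) (auto simp: on_def)
      moreover have "?W \<noteq> {}" using that unfolding L_def by (auto simp: not_le)
      ultimately have "Min ?W \<in> ?W" by (rule Min_in)
      moreover have "\<forall>w\<in>?W. Min ?W \<le> w" using \<open>finite ?W\<close> by (auto intro!: Min_le)
      ultimately have "edge c (fst p, Min ?W)" using I_on[of c p] that unfolding edge_def by force
      then show ?thesis by blast
    qed
    define g where "g i = (fst (snd i), SOME w. edge (fst i) (fst (snd i), w))" for i :: "(real \<times> real) \<times> (real \<times> real)"
    have g: "edge (fst i) (g i)" if "i \<in> ?I - L" for i
      unfolding g_def using someI_ex[OF ex[of "fst i" "snd i"]] that by auto
    have "inj_on g (?I - L)"
    proof (rule inj_onI)
      fix i j assume i: "i \<in> ?I - L" and j: "j \<in> ?I - L" and eq: "g i = g j"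
      have "fst i = fst j" using ctr_eq[OF g[OF i]] ctr_eq[OF g[OF j]] eq by simp
      moreover have "fst (snd i) = fst (snd j)" using eq unfolding g_def by simp
      then have "snd i = snd j" using i j by (intro inj_onD[OF inj]) (auto simp: upper_inc_def)
      ultimately show "i = j" by (simp add: prod_eq_iff)
    qed
    moreover have "g ` (?I - L) \<subseteq> E" using g unfolding E_def by blast
    ultimately show ?thesis using fE by (intro card_inj_on_le)
  qed
  moreover have "card ?I = card (?I - L) + card L"
  proof -
    have "L \<subseteq> ?I" unfolding L_def by auto
    then show ?thesis using fI by (metis card_Diff_subset card_mono finite_subset le_add_diff_inverse2)
  qed
  ultimately have "card ?I \<le> card E + card A" by linarith
  then have "real (card ?I) \<le> real (card E) + real (card A)" by linarith
  also have "\<dots> \<le> 6 * real k * (real (card A) * real (card B)) powr (2/3) + 4 * real k * real (card B) + real (card A)"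
    using E_bound V by simp
  also have "\<dots> \<le> 6 * real k * ((real (card A) * real (card B)) powr (2/3) + real (card A) + real (card B))"
  proof -
    have "real (card A) \<le> 6 * real k * real (card A)" using k by (simp add: mult_le_cancel_right1)
    moreover have "4 * real k * real (card B) \<le> 6 * real k * real (card B)" by (intro mult_right_mono) auto
    ultimately show ?thesis unfolding distrib_left by linarith
  qed
  finally show ?thesis .
qed


text \<open>Each pair of points at different heights rules out a single value of \<open>s\<close>,
  and there are finitely many pairs.\<close>

lemma exists_generic_shear:
  fixes B :: "(real \<times> real) set"
  assumes "finite B"
  shows "\<exists>s. inj_on (\<lambda>p. fst p + s * snd p) B"
proof -
  define bad where "bad = (\<lambda>(p, q). (fst q - fst p) / (snd p - snd q)) ` (B \<times> B)"
  have "finite bad" unfolding bad_def using assms by auto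
  then obtain s where s: "s \<notin> bad" using ex_new_if_finite[OF infinite_UNIV_char_0] by blast
  have "p = q" if pq: "p \<in> B" "q \<in> B" "fst p + s * snd p = fst q + s * snd q" for p q
  proof (cases "snd p = snd q")
    case True then show ?thesis using pq by (simp add: prod_eq_iff)
  next
    case False
    then have "s = (fst q - fst p) / (snd p - snd q)" using pq by (simp add: field_simps)
    then have "s \<in> bad" unfolding bad_def using pq by force
    with s show ?thesis by simp
  qed
  then show ?thesis unfolding inj_on_def by blast
qed

text \<open>The similarity \<open>(x, y) \<mapsto> (x + s y, y - s x)\<close> turns points in a generic position relative to \<open>s\<close>
  into points with distinct abscissae. Lower half circles of \<open>A\<close> are upper ones of \<open>B\<close>.\<close>

theorem card_incidences_le:
  assumes d: "d > 0" and fA: "finite A" and fB: "finite B"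
    and k: "card A \<le> 2 ^ k" "card B \<le> 2 ^ k" "k > 0"
  shows "real (card (incidences d A B)) \<le>
    12 * real k * ((real (card A) * real (card B)) powr (2/3) + real (card A) + real (card B))"
proof -
  obtain s where s: "inj_on (\<lambda>p. fst p + s * snd p) (A \<union> B)"
    using exists_generic_shear[of "A \<union> B"] fA fB by auto
  define T where "T p = (fst p + s * snd p, snd p - s * fst p)" for p :: "real \<times> real"
  define d' where "d' = sqrt (1 + s\<^sup>2) * d"
  have s0: "0 < 1 + s\<^sup>2" by (smt (verit) zero_le_power2)
  have d': "d' > 0" unfolding d'_def using d s0 by simp
  have distT: "dist (T p) (T q) = sqrt (1 + s\<^sup>2) * dist p q" for p q
  proof -
    have "(dist (T p) (T q))\<^sup>2 = (1 + s\<^sup>2) * (dist p q)\<^sup>2"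
      unfolding dist_sq T_def by (simp add: algebra_simps power2_eq_square)
    then have "sqrt ((dist (T p) (T q))\<^sup>2) = sqrt ((1 + s\<^sup>2) * (dist p q)\<^sup>2)" by simp
    then show ?thesis by (simp add: real_sqrt_mult)
  qed
  have Tinj: "p = q" if "T p = T q" for p q
  proof -
    have "sqrt (1 + s\<^sup>2) * dist p q = 0" using that distT[of p q] by simp
    then show ?thesis using s0 by simp
  qed
  have injT: "inj_on T X" for X using Tinj by (auto simp: inj_on_def)
  have gen: "inj_on fst (T ` X)" if "X \<subseteq> A \<union> B" for X
  proof (rule inj_onI)
    fix P Q assume "P \<in> T ` X" "Q \<in> T ` X" and eq: "fst P = fst Q"
    then obtain p q where pq: "p \<in> X" "q \<in> X" "P = T p" "Q = T q" by blast
    then have "p = q" using that eq by (intro inj_onD[OF s]) (auto simp: T_def)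
    then show "P = Q" using pq by simp
  qed
  have cT: "card (T ` X) = card X" for X by (rule card_image[OF injT])
  let ?AB = "upper_inc d' (T ` A) (T ` B)" and ?BA = "upper_inc d' (T ` B) (T ` A)"
  have fin: "finite ?AB" "finite ?BA"
    unfolding upper_inc_def using fA fB
    by (auto intro: finite_subset[of _ "T ` A \<times> T ` B"] finite_subset[of _ "T ` B \<times> T ` A"])
  \<comment> \<open>An incidence is symmetric in centre and point: whichever image is lower serves
    as the centre, and the tag records which of the two it was.\<close>
  let ?g = "\<lambda>(c, p). if snd (T c) \<le> snd (T p) then Inl (T c, T p) else Inr (T p, T c)"
  have "card (incidences d A B) \<le> card (?AB <+> ?BA)"
  proof (rule card_inj_on_le)
    show "inj_on ?g (incidences d A B)" using Tinj by (auto simp: inj_on_def split: if_splits)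
    show "?g ` incidences d A B \<subseteq> ?AB <+> ?BA"
      using distT by (auto simp: incidences_def upper_inc_def upper_def d'_def dist_commute)
  qed (use fin in auto)
  also have "\<dots> = card ?AB + card ?BA" using fin by (rule card_Plus)
  finally have "real (card (incidences d A B)) \<le> real (card ?AB) + real (card ?BA)" by linarith
  moreover have "real (card ?AB) \<le>
    6 * real k * ((real (card A) * real (card B)) powr (2/3) + real (card A) + real (card B))"
    using card_upper_inc_le_generic[OF d', of "T ` A" "T ` B" k] fA fB gen[of B] k by (simp add: cT)
  moreover have "real (card ?BA) \<le>
    6 * real k * ((real (card B) * real (card A)) powr (2/3) + real (card B) + real (card A))"
    using card_upper_inc_le_generic[OF d', of "T ` B" "T ` A" k] fA fB gen[of A] k by (simp add: cT)
  ultimately show ?thesis by (simp add: mult.commute algebra_simps)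
qed

section \<open>Chains\<close>

lemma card_le_fibres:
  assumes "finite B" "f ` A \<subseteq> B" "\<And>b. b \<in> B \<Longrightarrow> card {a\<in>A. f a = b} \<le> M"
  shows "card A \<le> M * card B"
proof -
  have "A = (\<Union>b\<in>B. {a\<in>A. f a = b})" using assms(2) by auto
  then have "card A = card (\<Union>b\<in>B. {a\<in>A. f a = b})" by (rule arg_cong)
  also have "\<dots> \<le> (\<Sum>b\<in>B. card {a\<in>A. f a = b})" using assms(1) by (rule card_UN_le)
  also have "\<dots> \<le> of_nat (card B) * M" by (rule sum_bounded_above) (rule assms(3))
  finally show ?thesis by (simp add: mult.commute)
qed

text \<open>With \<open>p\<close> as origin and \<open>u\<close> the position of \<open>q\<close>,
  two distinct common points have the same inner product with \<open>u\<close>, and their sum is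
  parallel to \<open>u\<close>. So one is the mirror image of the other in the line
  \<open>pq\<close>, and a third point would coincide with the second.\<close>

lemma circles_meet_twice:
  fixes p q :: "real \<times> real"
  assumes "p \<noteq> q"
  shows "finite {x. dist x p = r \<and> dist x q = s} \<and> card {x. dist x p = r \<and> dist x q = s} \<le> 2"
proof -
  let ?S = "{x. dist x p = r \<and> dist x q = s}"
  have three: "y = z" if xyz: "x \<in> ?S" "y \<in> ?S" "z \<in> ?S" "x \<noteq> y" "x \<noteq> z" for x y z
  proof -
    obtain p1 p2 u1 u2 x1 x2 y1 y2 z1 z2 where c: "p = (p1, p2)" "q = (p1 + u1, p2 + u2)"
      "x = (p1 + x1, p2 + x2)" "y = (p1 + y1, p2 + y2)" "z = (p1 + z1, p2 + z2)"
      by (metis add_diff_cancel_left' diff_add_cancel add.commute prod.exhaust)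
    have u: "u1 \<noteq> 0 \<or> u2 \<noteq> 0" using assms c by auto
    have eqs: "x1\<^sup>2 + x2\<^sup>2 = r\<^sup>2" "y1\<^sup>2 + y2\<^sup>2 = r\<^sup>2" "z1\<^sup>2 + z2\<^sup>2 = r\<^sup>2"
      "(x1 - u1)\<^sup>2 + (x2 - u2)\<^sup>2 = s\<^sup>2" "(y1 - u1)\<^sup>2 + (y2 - u2)\<^sup>2 = s\<^sup>2" "(z1 - u1)\<^sup>2 + (z2 - u2)\<^sup>2 = s\<^sup>2"
      using xyz dist_sq[of p x] dist_sq[of p y] dist_sq[of p z] dist_sq[of q x] dist_sq[of q y] dist_sq[of q z]
      unfolding c by (auto simp: dist_commute power2_commute)
    have perp: "a1 * u1 + a2 * u2 = b1 * u1 + b2 * u2" "(a1 + b1) * u2 = (a2 + b2) * u1"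
      if "a1\<^sup>2 + a2\<^sup>2 = r\<^sup>2" "b1\<^sup>2 + b2\<^sup>2 = r\<^sup>2" "(a1 - u1)\<^sup>2 + (a2 - u2)\<^sup>2 = s\<^sup>2" "(b1 - u1)\<^sup>2 + (b2 - u2)\<^sup>2 = s\<^sup>2"
        "a1 \<noteq> b1 \<or> a2 \<noteq> b2" for a1 a2 b1 b2
    proof -
      show 1: "a1 * u1 + a2 * u2 = b1 * u1 + b2 * u2" using that by algebra
      have "(a1 + b1) * (a1 - b1) + (a2 + b2) * (a2 - b2) = 0" using that by algebra
      then have "(a1 - b1) * ((a1 + b1) * u2 - (a2 + b2) * u1) = 0"
        "(a2 - b2) * ((a1 + b1) * u2 - (a2 + b2) * u1) = 0" using 1 by algebra+
      then show "(a1 + b1) * u2 = (a2 + b2) * u1" using that(5) by auto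
    qed
    have xy: "x1 \<noteq> y1 \<or> x2 \<noteq> y2" "x1 \<noteq> z1 \<or> x2 \<noteq> z2" using xyz c by auto
    note a = perp[OF eqs(1,2,4,5) xy(1)] perp[OF eqs(1,3,4,6) xy(2)]
    have "(u1\<^sup>2 + u2\<^sup>2) * (y1 - z1) = 0" "(u1\<^sup>2 + u2\<^sup>2) * (y2 - z2) = 0" using a by algebra+
    moreover have "u1\<^sup>2 + u2\<^sup>2 \<noteq> 0" using u by (simp add: sum_power2_eq_zero_iff)
    ultimately show "y = z" using c by auto
  qed
  show ?thesis
  proof (cases "\<exists>x y. x \<in> ?S \<and> y \<in> ?S \<and> x \<noteq> y")
    case True
    then obtain x y where xy: "x \<in> ?S" "y \<in> ?S" "x \<noteq> y" by blast
    have sub: "?S \<subseteq> {x, y}" using three[OF xy(1,2) _ xy(3)] by blast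
    have "card ?S \<le> card {x, y}" by (rule card_mono[OF _ sub]) simp
    then show ?thesis using finite_subset[OF sub] xy(3) by simp
  next
    case False
    then obtain x where sub: "?S \<subseteq> {x}" by blast
    have "card ?S \<le> card {x}" by (rule card_mono[OF _ sub]) simp
    then show ?thesis using finite_subset[OF sub] by simp
  qed
qed

section \<open>Reversing chains and removing points from them\<close>

lemma chain_tuplesI:
  assumes "p \<in> extensional {0..k}" "\<And>i. i \<le> k \<Longrightarrow> p i \<in> P i"
    "\<And>i. i < k \<Longrightarrow> dist (p i) (p (Suc i)) = \<delta> i" "\<And>i j. i \<le> k \<Longrightarrow> j \<le> k \<Longrightarrow> p i = p j \<Longrightarrow> i = j"
  shows "p \<in> chain_tuples k \<delta> P"
  using assms unfolding chain_tuples_def by (auto simp: PiE_iff inj_on_def)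

lemma chain_tuplesD:
  assumes "p \<in> chain_tuples k \<delta> P"
  shows "p \<in> extensional {0..k}" "i \<le> k \<Longrightarrow> p i \<in> P i" "i < k \<Longrightarrow> dist (p i) (p (Suc i)) = \<delta> i"
    "i \<le> k \<Longrightarrow> j \<le> k \<Longrightarrow> p i = p j \<Longrightarrow> i = j"
  using assms unfolding chain_tuples_def by (auto simp: PiE_iff inj_on_def)

lemma finite_chain_tuples:
  assumes "\<And>i. i \<le> k \<Longrightarrow> finite (P i)"
  shows "finite (chain_tuples k \<delta> P)"
proof (rule finite_subset)
  show "chain_tuples k \<delta> P \<subseteq> (\<Pi>\<^sub>E i\<in>{0..k}. P i)"
    by (auto simp: chain_tuples_def PiE_iff extensional_def)
  show "finite (\<Pi>\<^sub>E i\<in>{0..k}. P i)" using assms by (intro finite_PiE) auto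
qed

lemma Ck_cong:
  assumes "\<And>i. i < k \<Longrightarrow> \<delta> i = \<delta>' i" "\<And>i. i \<le> k \<Longrightarrow> P i = P' i"
  shows "Ck k \<delta> P = Ck k \<delta>' P'"
proof -
  have "chain_tuples k \<delta> P = chain_tuples k \<delta>' P'" unfolding chain_tuples_def using assms by auto
  then show ?thesis unfolding Ck_def by simp
qed

lemma Ck_reverse_le:
  assumes "\<And>i. i \<le> k \<Longrightarrow> finite (P i)"
  shows "Ck k \<delta> P \<le> Ck k (\<lambda>i. \<delta> (k - Suc i)) (\<lambda>i. P (k - i))"
  unfolding Ck_def
proof (rule card_inj_on_le)
  let ?r = "\<lambda>p. restrict (\<lambda>i. p (k - i)) {0..k}"
  show "inj_on ?r (chain_tuples k \<delta> P)"
  proof (rule inj_onI)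
    fix p q assume p: "p \<in> chain_tuples k \<delta> P" and q: "q \<in> chain_tuples k \<delta> P" and eq: "?r p = ?r q"
    have "p i = q i" if "i \<in> {0..k}" for i using fun_cong[OF eq, of "k - i"] that by simp
    then show "p = q" by (rule extensionalityI[OF chain_tuplesD(1)[OF p] chain_tuplesD(1)[OF q]])
  qed
  show "?r ` chain_tuples k \<delta> P \<subseteq> chain_tuples k (\<lambda>i. \<delta> (k - Suc i)) (\<lambda>i. P (k - i))"
  proof (rule image_subsetI, rule chain_tuplesI)
    fix p i assume p: "p \<in> chain_tuples k \<delta> P"
    show "dist (?r p i) (?r p (Suc i)) = \<delta> (k - Suc i)" if "i < k"
      using chain_tuplesD(3)[OF p, of "k - Suc i"] that by (simp add: dist_commute Suc_diff_Suc)
    show "i = j" if "i \<le> k" "j \<le> k" "?r p i = ?r p j" for j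
      using chain_tuplesD(4)[OF p, of "k - i" "k - j"] that by auto
  qed (use chain_tuplesD(2) in auto)
  show "finite (chain_tuples k (\<lambda>i. \<delta> (k - Suc i)) (\<lambda>i. P (k - i)))"
    using assms by (intro finite_chain_tuples) auto
qed

text \<open>Reversing twice restores the chain, so the injection of \<open>Ck_reverse_le\<close> can
  be used in both directions. This transfers statements about the start of a chain to its
  end.\<close>

lemma Ck_reverse:
  assumes "\<And>i. i \<le> k \<Longrightarrow> finite (P i)"
  shows "Ck k (\<lambda>i. \<delta> (k - Suc i)) (\<lambda>i. P (k - i)) = Ck k \<delta> P"
proof (rule antisym)
  have "Ck k (\<lambda>i. \<delta> (k - Suc i)) (\<lambda>i. P (k - i))
     \<le> Ck k (\<lambda>i. \<delta> (k - Suc (k - Suc i))) (\<lambda>i. P (k - (k - i)))"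
    using assms by (intro Ck_reverse_le) auto
  also have "\<dots> = Ck k \<delta> P" by (rule Ck_cong) (auto simp: Suc_diff_Suc)
  finally show "Ck k (\<lambda>i. \<delta> (k - Suc i)) (\<lambda>i. P (k - i)) \<le> Ck k \<delta> P" .
qed (use Ck_reverse_le assms in auto)

definition tail :: "nat \<Rightarrow> nat \<Rightarrow> (nat \<Rightarrow> 'a) \<Rightarrow> nat \<Rightarrow> 'a" where
  "tail s k p = restrict (\<lambda>i. p (i + s)) {0..k}"

lemma tail_0 [simp]: "tail s k p 0 = p s"
  by (simp add: tail_def)

lemma tail_in_chain_tuples:
  assumes p: "p \<in> chain_tuples (k + s) \<delta> P"
  shows "tail s k p \<in> chain_tuples k (\<lambda>i. \<delta> (i + s)) (\<lambda>i. P (i + s))"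
proof (rule chain_tuplesI)
  show "i = j" if "i \<le> k" "j \<le> k" "tail s k p i = tail s k p j" for i j
    using chain_tuplesD(4)[OF p, of "i + s" "j + s"] that by (auto simp: tail_def)
  show "dist (tail s k p i) (tail s k p (Suc i)) = \<delta> (i + s)" if "i < k" for i
    using chain_tuplesD(3)[OF p, of "i + s"] that by (auto simp: tail_def)
qed (use chain_tuplesD(2)[OF p] in \<open>auto simp: tail_def\<close>)

lemma chain_eqI:
  assumes p: "p \<in> chain_tuples (k + s) \<delta> P" "q \<in> chain_tuples (k + s) \<delta> P"
    and "tail s k p = tail s k q" "\<And>i. i < s \<Longrightarrow> p i = q i"
  shows "p = q"
proof (rule extensionalityI[OF chain_tuplesD(1)[OF p(1)] chain_tuplesD(1)[OF p(2)]])
  fix i assume i: "i \<in> {0..k + s}"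
  show "p i = q i"
  proof (cases "i < s")
    case False
    then have "i = (i - s) + s" "i - s \<le> k" using i by auto
    then show ?thesis using fun_cong[OF assms(3), of "i - s"] by (auto simp: tail_def)
  qed (use assms in auto)
qed

text \<open>Over a fixed remainder, the removed point is one of the neighbours in \<open>P 0\<close>
  of the first remaining point.\<close>

lemma Ck_drop_first:
  assumes fin: "\<And>i. i \<le> Suc k \<Longrightarrow> finite (P i)"
    and D: "\<And>q. q \<in> P 1 \<Longrightarrow> card {p \<in> P 0. dist p q = \<delta> 0} \<le> D"
  shows "Ck (Suc k) \<delta> P \<le> D * Ck k (\<lambda>i. \<delta> (i + 1)) (\<lambda>i. P (i + 1))"
  unfolding Ck_def
proof (rule card_le_fibres)
  show "finite (chain_tuples k (\<lambda>i. \<delta> (i + 1)) (\<lambda>i. P (i + 1)))"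
    using fin by (intro finite_chain_tuples) auto
  show "tail 1 k ` chain_tuples (Suc k) \<delta> P \<subseteq> chain_tuples k (\<lambda>i. \<delta> (i + 1)) (\<lambda>i. P (i + 1))"
    using tail_in_chain_tuples[of _ k 1] by auto
  fix q assume q: "q \<in> chain_tuples k (\<lambda>i. \<delta> (i + 1)) (\<lambda>i. P (i + 1))"
  let ?S = "{p \<in> chain_tuples (Suc k) \<delta> P. tail 1 k p = q}"
  have "card ?S \<le> card {p \<in> P 0. dist p (q 0) = \<delta> 0}"
  proof (rule card_inj_on_le[of "\<lambda>p. p 0"])
    show "inj_on (\<lambda>p. p 0) ?S"
      by (rule inj_onI, rule chain_eqI[where s = 1 and k = k]) auto
    have "p 0 \<in> P 0 \<and> dist (p 0) (q 0) = \<delta> 0" if "p \<in> ?S" for p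
      using that chain_tuplesD(2)[of p "Suc k" \<delta> P 0] chain_tuplesD(3)[of p "Suc k" \<delta> P 0] by (auto simp: tail_def)
    then show "(\<lambda>p. p 0) ` ?S \<subseteq> {p \<in> P 0. dist p (q 0) = \<delta> 0}" by blast
  qed (use fin in auto)
  also have "\<dots> \<le> D" using chain_tuplesD(2)[OF q, of 0] by (intro D) auto
  finally show "card ?S \<le> D" .
qed

lemma Ck_drop_last:
  assumes fin: "\<And>i. i \<le> Suc k \<Longrightarrow> finite (P i)"
    and D: "\<And>q. q \<in> P k \<Longrightarrow> card {p \<in> P (Suc k). dist p q = \<delta> k} \<le> D"
  shows "Ck (Suc k) \<delta> P \<le> D * Ck k \<delta> P"
proof -
  have "Ck (Suc k) \<delta> P = Ck (Suc k) (\<lambda>i. \<delta> (Suc k - Suc i)) (\<lambda>i. P (Suc k - i))"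
    using Ck_reverse[of "Suc k" P \<delta>] fin by auto
  also have "\<dots> \<le> D * Ck k (\<lambda>i. \<delta> (Suc k - Suc (i + 1))) (\<lambda>i. P (Suc k - (i + 1)))"
    using fin D by (intro Ck_drop_first) auto
  also have "Ck k (\<lambda>i. \<delta> (Suc k - Suc (i + 1))) (\<lambda>i. P (Suc k - (i + 1))) = Ck k \<delta> P"
    using Ck_reverse[of k P \<delta>] fin by auto
  finally show ?thesis .
qed

text \<open>Once the first and third points are fixed, the second lies on two circles around them.
  The centres differ because the points of a chain are distinct.\<close>

lemma Ck_split_second:
  assumes fin: "\<And>i. i \<le> k + 2 \<Longrightarrow> finite (P i)"
  shows "Ck (k + 2) \<delta> P \<le> 2 * (card (P 0) * Ck k (\<lambda>i. \<delta> (i + 2)) (\<lambda>i. P (i + 2)))"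
  unfolding Ck_def card_cartesian_product[symmetric]
proof (rule card_le_fibres)
  let ?C = "chain_tuples k (\<lambda>i. \<delta> (i + 2)) (\<lambda>i. P (i + 2))"
  let ?f = "\<lambda>p. (p 0, tail 2 k p)"
  show "finite (P 0 \<times> ?C)" using fin by (intro finite_cartesian_product finite_chain_tuples) auto
  show "?f ` chain_tuples (k + 2) \<delta> P \<subseteq> P 0 \<times> ?C"
    using tail_in_chain_tuples[of _ k 2] chain_tuplesD(2)[of _ "k + 2" \<delta> P 0] by blast
  fix b assume "b \<in> P 0 \<times> ?C"
  let ?S = "{p \<in> chain_tuples (k + 2) \<delta> P. ?f p = b}"
  show "card ?S \<le> 2"
  proof (cases "?S = {}")
    case False
    then obtain p where p: "p \<in> chain_tuples (k + 2) \<delta> P" "?f p = b" by blast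
    have ne: "p 0 \<noteq> p 2" using chain_tuplesD(4)[OF p(1), of 0 2] by auto
    have p2: "r 0 = p 0 \<and> r 2 = p 2" if "r \<in> ?S" for r
    proof -
      have "tail 2 k r = tail 2 k p" using that p by auto
      then have "tail 2 k r 0 = tail 2 k p 0" by (rule arg_cong)
      then show ?thesis using that p by auto
    qed
    let ?D = "{x. dist x (p 0) = \<delta> 0 \<and> dist x (p 2) = \<delta> 1}"
    have "card ?S \<le> card ?D"
    proof (rule card_inj_on_le[of "\<lambda>r. r 1"])
      show "inj_on (\<lambda>r. r 1) ?S"
        by (rule inj_onI, rule chain_eqI[where s = 2 and k = k]) (auto simp: less_2_cases_iff)
      have "dist (r 1) (p 0) = \<delta> 0 \<and> dist (r 1) (p 2) = \<delta> 1" if "r \<in> ?S" for r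
        using that p2[OF that] chain_tuplesD(3)[of r "k + 2" \<delta> P 0] chain_tuplesD(3)[of r "k + 2" \<delta> P 1]
        by (auto simp: dist_commute numeral_2_eq_2)
      then show "(\<lambda>r. r 1) ` ?S \<subseteq> ?D" by blast
    qed (use circles_meet_twice[OF ne] in auto)
    also have "\<dots> \<le> 2" using circles_meet_twice[OF ne] by blast
    finally show ?thesis .
  next
    case True
    then show ?thesis by (simp only: card.empty)
  qed
qed

text \<open>The third point lies on two circles around the distinct second and fourth points. Here
  the first two points are kept together as an incidence, so a good incidence bound can be
  inserted.\<close>

lemma Ck_split_third:
  assumes fin: "\<And>i. i \<le> k + 3 \<Longrightarrow> finite (P i)"
  shows "Ck (k + 3) \<delta> P \<le>
    2 * (card (incidences (\<delta> 0) (P 0) (P 1)) * Ck k (\<lambda>i. \<delta> (i + 3)) (\<lambda>i. P (i + 3)))"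
  unfolding Ck_def card_cartesian_product[symmetric]
proof (rule card_le_fibres)
  let ?C = "chain_tuples k (\<lambda>i. \<delta> (i + 3)) (\<lambda>i. P (i + 3))" and ?I = "incidences (\<delta> 0) (P 0) (P 1)"
  let ?f = "\<lambda>p. ((p 0, p 1), tail 3 k p)"
  have "finite ?I" unfolding incidences_def
    by (rule finite_subset[of _ "P 0 \<times> P 1"]) (use fin[of 0] fin[of 1] in auto)
  then show "finite (?I \<times> ?C)" using fin by (intro finite_cartesian_product finite_chain_tuples) auto
  have "(p 0, p 1) \<in> ?I" if "p \<in> chain_tuples (k + 3) \<delta> P" for p
    using chain_tuplesD(2)[OF that, of 0] chain_tuplesD(2)[OF that, of 1] chain_tuplesD(3)[OF that, of 0]
    by (auto simp: incidences_def)
  then show "?f ` chain_tuples (k + 3) \<delta> P \<subseteq> ?I \<times> ?C"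
    using tail_in_chain_tuples[of _ k 3] by blast
  fix b assume "b \<in> ?I \<times> ?C"
  let ?S = "{p \<in> chain_tuples (k + 3) \<delta> P. ?f p = b}"
  show "card ?S \<le> 2"
  proof (cases "?S = {}")
    case False
    then obtain p where p: "p \<in> chain_tuples (k + 3) \<delta> P" "?f p = b" by blast
    have ne: "p 1 \<noteq> p 3" using chain_tuplesD(4)[OF p(1), of 1 3] by auto
    have p2: "r 0 = p 0 \<and> r 1 = p 1 \<and> r 3 = p 3" if "r \<in> ?S" for r
    proof -
      have "tail 3 k r = tail 3 k p" using that p by auto
      then have "tail 3 k r 0 = tail 3 k p 0" by (rule arg_cong)
      then show ?thesis using that p by auto
    qed
    let ?D = "{x. dist x (p 1) = \<delta> 1 \<and> dist x (p 3) = \<delta> 2}"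
    have "card ?S \<le> card ?D"
    proof (rule card_inj_on_le[of "\<lambda>r. r 2"])
      show "inj_on (\<lambda>r. r 2) ?S"
      proof (rule inj_onI)
        fix r s assume r: "r \<in> ?S" and s: "s \<in> ?S" and eq: "r 2 = s 2"
        have lt: "r i = s i" if "i < 3" for i
        proof -
          have "i = 0 \<or> i = 1 \<or> i = 2" using that by linarith
          then show ?thesis using p2[OF r] p2[OF s] eq by auto
        qed
        have "snd (?f r) = snd (?f s)" using r s by (metis (mono_tags, lifting) mem_Collect_eq)
        then have "tail 3 k r = tail 3 k s" by (simp only: snd_conv)
        moreover have "r \<in> chain_tuples (k + 3) \<delta> P" "s \<in> chain_tuples (k + 3) \<delta> P"
          using r s by blast+
        ultimately show "r = s" using lt chain_eqI[of r k 3 \<delta> P s] by blast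
      qed
      have "dist (r 2) (p 1) = \<delta> 1 \<and> dist (r 2) (p 3) = \<delta> 2" if "r \<in> ?S" for r
      proof -
        have "r \<in> chain_tuples (k + 3) \<delta> P" using that by blast
        then have "dist (r 1) (r (Suc 1)) = \<delta> 1" "dist (r 2) (r (Suc 2)) = \<delta> 2"
          by (rule chain_tuplesD(3), simp)+
        moreover have "Suc 1 = 2" "Suc 2 = 3" by simp_all
        ultimately show ?thesis using p2[OF that] by (metis dist_commute)
      qed
      then show "(\<lambda>r. r 2) ` ?S \<subseteq> ?D" by blast
    qed (use circles_meet_twice[OF ne] in auto)
    also have "\<dots> \<le> 2" using circles_meet_twice[OF ne] by blast
    finally show ?thesis .
  next
    case True
    then show ?thesis by (simp only: card.empty)
  qed
qed

section \<open>The induction\<close>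

definition cbrt :: "nat \<Rightarrow> real" where
  "cbrt n = root 3 (real n)"

lemma cbrt_nonneg [simp]: "0 \<le> cbrt n"
  by (simp add: cbrt_def)

lemma cbrt_cube: "cbrt n ^ 3 = real n"
  by (simp add: cbrt_def)

lemma cbrt_mono: "m \<le> n \<Longrightarrow> cbrt m \<le> cbrt n"
  by (simp add: cbrt_def)

lemma cbrt_ge_one: "1 \<le> n \<Longrightarrow> 1 \<le> cbrt n"
  by (simp add: cbrt_def)

lemma le_cbrt_mult:
  assumes "a \<le> n"
  shows "real a \<le> cbrt a * cbrt n ^ 2"
proof -
  have "real a = cbrt a * cbrt a ^ 2" using cbrt_cube[of a] by (simp add: power2_eq_square power3_eq_cube)
  also have "\<dots> \<le> cbrt a * cbrt n ^ 2"
    using cbrt_mono[OF assms] by (intro mult_left_mono power_mono) auto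
  finally show ?thesis .
qed

text \<open>The number \<open>m\<close> plays the role of log n. All sets, including the two end
  sets, are only required to have at most \<open>n\<close> points; the actual end sizes enter
  through \<open>size_bound\<close>.\<close>

definition admissible :: "nat \<Rightarrow> (nat \<Rightarrow> real) \<Rightarrow> (nat \<Rightarrow> (real \<times> real) set) \<Rightarrow> nat \<Rightarrow> nat \<Rightarrow> bool" where
  "admissible k \<delta> P n m \<longleftrightarrow> (\<forall>i<k. 0 < \<delta> i) \<and> (\<forall>i\<le>k. finite (P i) \<and> card (P i) \<le> n) \<and> n \<le> 2 ^ m \<and> 1 \<le> m"

definition size_bound :: "nat \<Rightarrow> (nat \<Rightarrow> (real \<times> real) set) \<Rightarrow> nat \<Rightarrow> real" where
  "size_bound k P n = cbrt n ^ fk k * cbrt (card (P 0)) * cbrt (card (P k))"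

text \<open>The constants are uniform in the distances and the sets, since the induction applies the
  bound to shifted and reversed chains and to dyadic subsets.\<close>

definition chain_bound :: "nat \<Rightarrow> real \<Rightarrow> nat \<Rightarrow> bool" where
  "chain_bound k K c \<longleftrightarrow> 0 \<le> K \<and> (\<forall>\<delta> P n m. admissible k \<delta> P n m \<longrightarrow>
     real (Ck k \<delta> P) \<le> K * real m ^ c * size_bound k P n)"

lemma size_bound_nonneg [simp]: "0 \<le> size_bound k P n"
  by (simp add: size_bound_def)

lemma chain_boundD:
  "chain_bound k K c \<Longrightarrow> admissible k \<delta> P n m \<Longrightarrow> real (Ck k \<delta> P) \<le> K * real m ^ c * size_bound k P n"
  by (auto simp: chain_bound_def)

lemma chain_bound_mono:
  assumes "chain_bound k K c" "K \<le> K'" "c \<le> c'"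
  shows "chain_bound k K' c'"
  unfolding chain_bound_def
proof (intro conjI allI impI)
  have K: "0 \<le> K" using assms unfolding chain_bound_def by auto
  then show "0 \<le> K'" using assms by linarith
  fix \<delta> P n m assume a: "admissible k \<delta> P n m"
  then have "1 \<le> real m" unfolding admissible_def by simp
  then have "real m ^ c \<le> real m ^ c'" using assms by (intro power_increasing) auto
  then have "K * real m ^ c * size_bound k P n \<le> K' * real m ^ c' * size_bound k P n"
    using K assms by (intro mult_right_mono mult_mono) auto
  then show "real (Ck k \<delta> P) \<le> K' * real m ^ c' * size_bound k P n"
    using chain_boundD[OF assms(1) a] by linarith
qed

lemma admissible_tail:
  "admissible (k + s) \<delta> P n m \<Longrightarrow> admissible k (\<lambda>i. \<delta> (i + s)) (\<lambda>i. P (i + s)) n m"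
  unfolding admissible_def by auto

lemma admissible_init: "admissible (Suc k) \<delta> P n m \<Longrightarrow> admissible k \<delta> P n m"
  unfolding admissible_def by auto

lemma admissible_reverse:
  "admissible k \<delta> P n m \<Longrightarrow> admissible k (\<lambda>i. \<delta> (k - Suc i)) (\<lambda>i. P (k - i)) n m"
  unfolding admissible_def by auto

lemma admissible_update:
  assumes "admissible k \<delta> P n m" "Q \<subseteq> P i" "i \<le> k"
  shows "admissible k \<delta> (P(i := Q)) n m"
proof -
  have "finite (P i)" "card (P i) \<le> n" using assms unfolding admissible_def by auto
  then have "finite Q" "card Q \<le> n"
    using finite_subset[OF assms(2)] card_mono[OF _ assms(2)] by auto
  then show ?thesis using assms(1) unfolding admissible_def by auto
qed

lemma admissibleD:
  assumes "admissible k \<delta> P n m"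
  shows "i < k \<Longrightarrow> 0 < \<delta> i" "i \<le> k \<Longrightarrow> finite (P i)" "i \<le> k \<Longrightarrow> card (P i) \<le> n"
    "n \<le> 2 ^ m" "1 \<le> m" "i \<le> k \<Longrightarrow> card (P i) \<le> 2 ^ m" "i \<le> k \<Longrightarrow> cbrt (card (P i)) \<le> cbrt n"
proof -
  show n: "n \<le> 2 ^ m" and "1 \<le> m" and "i < k \<Longrightarrow> 0 < \<delta> i" and "i \<le> k \<Longrightarrow> finite (P i)"
    and le: "i \<le> k \<Longrightarrow> card (P i) \<le> n"
    using assms unfolding admissible_def by blast+
  show "i \<le> k \<Longrightarrow> card (P i) \<le> 2 ^ m" using n le by linarith
  show "i \<le> k \<Longrightarrow> cbrt (card (P i)) \<le> cbrt n" using cbrt_mono le by blast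
qed

lemma size_bound_reverse: "size_bound k (\<lambda>i. P (k - i)) n = size_bound k P n"
  unfolding size_bound_def by simp

section \<open>Degrees, dyadic classes and the rich-poor dichotomy\<close>

definition degree :: "real \<Rightarrow> (real \<times> real) set \<Rightarrow> real \<times> real \<Rightarrow> nat" where
  "degree d A q = card {p \<in> A. dist p q = d}"

lemma card_incidences_eq:
  assumes "finite A" "finite B"
  shows "card (incidences d A B) = (\<Sum>q\<in>B. degree d A q)"
proof -
  have "incidences d A B = prod.swap ` (SIGMA q:B. {p \<in> A. dist p q = d})"
    unfolding incidences_def by force
  then have "card (incidences d A B) = card (SIGMA q:B. {p \<in> A. dist p q = d})"
    by (simp add: card_image)
  also have "\<dots> = (\<Sum>q\<in>B. degree d A q)" using assms by (simp add: degree_def)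
  finally show ?thesis .
qed

lemma card_incidences_le_cbrt:
  assumes "d > 0" "finite A" "finite B" "card A \<le> 2 ^ m" "card B \<le> 2 ^ m" "m \<ge> 1"
  shows "real (card (incidences d A B)) \<le>
    12 * real m * ((cbrt (card A) * cbrt (card B)) ^ 2 + cbrt (card A) ^ 3 + cbrt (card B) ^ 3)"
proof -
  let ?x = "real (card A) * real (card B)"
  have "?x powr (2/3) = root 3 ?x ^ 2"
  proof (cases "?x = 0")
    case False
    then have "root 3 ?x = ?x powr (1/3)" by (simp add: root_powr_inverse)
    then show ?thesis by (simp add: power2_eq_square powr_add[symmetric])
  qed auto
  then have "?x powr (2/3) = (cbrt (card A) * cbrt (card B)) ^ 2"
    by (simp add: cbrt_def real_root_mult)
  then show ?thesis using card_incidences_le[OF assms(1-5)] assms(6) by (simp add: cbrt_cube)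
qed

text \<open>Let a, b be the cube roots of the sizes of \<open>A\<close>, \<open>B\<close>. The
  number of incidences is at least r b^3 and at most 12 m (a^2 b^2 + a^3 + b^3). If a^3 is the
  largest term, the first alternative holds. Otherwise dividing by b^2 gives r b at most 36 m a^2 or
  36 m b, and \<open>E\<close> dominates both. \<open>E\<close> is left open because different upper
  bounds for b are available in different uses.\<close>

lemma rich_dichotomy:
  assumes d: "d > 0" and fin: "finite A" "finite B" and m: "card A \<le> 2 ^ m" "card B \<le> 2 ^ m" "m \<ge> 1"
    and r: "\<And>q. q \<in> B \<Longrightarrow> r \<le> degree d A q"
    and E: "card A > 0 \<Longrightarrow> cbrt (card B) \<le> E \<and> cbrt (card A) ^ 2 \<le> E"
  shows "real (card (incidences d A B)) \<le> 36 * real m * real (card A) \<or> real r * cbrt (card B) \<le> 36 * real m * E"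
proof (cases "A = {} \<or> B = {}")
  case True
  then have "incidences d A B = {}" unfolding incidences_def by auto
  then show ?thesis by simp
next
  case False
  define I \<alpha> \<beta> where "I = real (card (incidences d A B))" and "\<alpha> = cbrt (card A)" and "\<beta> = cbrt (card B)"
  have A: "card A > 0" "card B > 0" using False fin by (auto simp: card_gt_0_iff)
  then have \<alpha>\<beta>: "0 < \<alpha>" "0 < \<beta>" using cbrt_ge_one[of "card A"] cbrt_ge_one[of "card B"] unfolding \<alpha>_def \<beta>_def by auto
  have E': "\<beta> \<le> E" "\<alpha> ^ 2 \<le> E" using E A unfolding \<alpha>_def \<beta>_def by auto
  have "of_nat (card B) * r \<le> (\<Sum>q\<in>B. degree d A q)" by (rule sum_bounded_below) (rule r)
  then have "card B * r \<le> card (incidences d A B)" using card_incidences_eq[OF fin] by simp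
  then have "real (card B * r) \<le> I" unfolding I_def by (simp only: of_nat_le_iff)
  then have rI: "real r * \<beta> ^ 3 \<le> I" unfolding \<beta>_def cbrt_cube by (simp add: mult.commute)
  have ub: "I \<le> 12 * real m * ((\<alpha> * \<beta>) ^ 2 + \<alpha> ^ 3 + \<beta> ^ 3)"
    using card_incidences_le_cbrt[OF d fin m] unfolding I_def \<alpha>_def \<beta>_def .
  show ?thesis
  proof (rule ccontr)
    assume "\<not> ?thesis"
    then have c: "36 * real m * \<alpha> ^ 3 < I" "36 * real m * E < real r * \<beta>"
      unfolding I_def \<alpha>_def \<beta>_def cbrt_cube by auto
    have "36 * real m * E * \<beta> ^ 2 \<le> real r * \<beta> * \<beta> ^ 2" using c(2) by (intro mult_right_mono) auto
    also have "\<dots> = real r * \<beta> ^ 3" by (simp add: power2_eq_square power3_eq_cube)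
    finally have b: "36 * real m * E * \<beta> ^ 2 \<le> I" using rI by linarith
    have "36 * real m * \<beta> * \<beta> ^ 2 \<le> 36 * real m * E * \<beta> ^ 2"
      using E' by (intro mult_right_mono mult_left_mono) auto
    then have 1: "36 * real m * \<beta> ^ 3 \<le> I" using b by (simp add: power2_eq_square power3_eq_cube)
    have "36 * real m * \<alpha> ^ 2 * \<beta> ^ 2 \<le> 36 * real m * E * \<beta> ^ 2"
      using E' by (intro mult_right_mono mult_left_mono) auto
    then have 2: "36 * real m * (\<alpha> * \<beta>) ^ 2 \<le> I" using b by (simp add: power_mult_distrib)
    have "3 * I \<le> 36 * real m * (\<alpha> * \<beta>) ^ 2 + 36 * real m * \<alpha> ^ 3 + 36 * real m * \<beta> ^ 3"
      using ub by (simp add: distrib_left)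
    then show False using c(1) 1 2 by linarith
  qed
qed

definition rich :: "real \<Rightarrow> (real \<times> real) set \<Rightarrow> (real \<times> real) set \<Rightarrow> nat \<Rightarrow> (real \<times> real) set" where
  "rich d A B j = {q \<in> B. 2 ^ j \<le> degree d A q \<and> degree d A q < 2 ^ Suc j}"

lemma rich_subset: "rich d A B j \<subseteq> B"
  by (auto simp: rich_def)

lemma exists_rich:
  assumes "finite A" "card A \<le> 2 ^ m" "p \<in> A" "q \<in> B" "dist p q = d"
  shows "\<exists>j\<le>m. q \<in> rich d A B j"
proof -
  have "p \<in> {p \<in> A. dist p q = d}" using assms by blast
  moreover have "finite {p \<in> A. dist p q = d}" using assms(1) by simp
  ultimately have "0 < degree d A q" unfolding degree_def by (metis card_gt_0_iff empty_iff)
  then obtain j where j: "2 ^ j \<le> degree d A q" "degree d A q < 2 ^ Suc j"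
    using ex_power_ivl1[of 2 "degree d A q"] by auto
  have "degree d A q \<le> card A" unfolding degree_def using assms(1) by (intro card_mono) auto
  then have "(2::nat) ^ j \<le> 2 ^ m" using j assms(2) by linarith
  then have "j \<le> m" by simp
  then show ?thesis using j assms(4) by (auto simp: rich_def)
qed

text \<open>In a chain the point at \<open>i\<close> has the point at \<open>i'\<close> as a
  neighbour, so its degree lies between 1 and \<open>2 ^ m\<close> and one of the classes 0 to
  \<open>m\<close> contains it.\<close>

lemma Ck_le_sum_rich:
  assumes adm: "admissible k \<delta> P n m" and i: "i \<le> k" "i' \<le> k"
    and d: "\<And>p. p \<in> chain_tuples k \<delta> P \<Longrightarrow> dist (p i') (p i) = d"
  shows "Ck k \<delta> P \<le> (\<Sum>j\<le>m. Ck k \<delta> (P(i := rich d (P i') (P i) j)))"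
proof -
  let ?Q = "\<lambda>j. chain_tuples k \<delta> (P(i := rich d (P i') (P i) j))"
  have "chain_tuples k \<delta> P \<subseteq> (\<Union>j\<in>{..m}. ?Q j)"
  proof
    fix p assume p: "p \<in> chain_tuples k \<delta> P"
    have "\<exists>j\<le>m. p i \<in> rich d (P i') (P i) j"
      using admissibleD[OF adm] i chain_tuplesD(2)[OF p] d[OF p] by (intro exists_rich[of _ _ "p i'"]) auto
    then obtain j where "j \<le> m" "p i \<in> rich d (P i') (P i) j" by auto
    then show "p \<in> (\<Union>j\<in>{..m}. ?Q j)" using p by (auto simp: chain_tuples_def)
  qed
  moreover have fin: "finite (?Q j)" for j
    using admissibleD(2)[OF admissible_update[OF adm rich_subset i(1)]] by (intro finite_chain_tuples)
  ultimately have "card (chain_tuples k \<delta> P) \<le> card (\<Union>j\<in>{..m}. ?Q j)" by (intro card_mono) auto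
  also have "\<dots> \<le> (\<Sum>j\<le>m. card (?Q j))" by (rule card_UN_le) simp
  finally show ?thesis unfolding Ck_def .
qed

lemma fk_add3: "fk (i + 3) = fk i + 3"
proof -
  have "(i + 3) mod 3 = i mod 3" by presburger
  then show ?thesis unfolding fk_def by (simp split: if_split)
qed

lemma fk_add3_eq:
  assumes "i mod 3 = 0"
  shows "fk (i + 3) = fk (i + 1) + 2"
proof -
  have "(i + 3) mod 3 = 0" "(i + 1) mod 3 = 1" using assms by presburger+
  then show ?thesis by (simp add: fk_def)
qed

text \<open>Keep the incidence of the first two points and the chain from the fourth point on. The
  bound on the first set contributes two factors \<open>cbrt n\<close>, and replacing the size of
  the new first set by \<open>n\<close> contributes a third, which matches \<open>fk_add3\<close>.
  The constant is 2 times 36.\<close>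

lemma Ck_bound_few_incidences:
  assumes cb: "chain_bound i K c" and adm: "admissible (i + 3) \<delta> P n m"
    and I: "real (card (incidences (\<delta> 0) (P 0) (P 1))) \<le> 36 * real m * real (card (P 0))"
  shows "real (Ck (i + 3) \<delta> P) \<le> 72 * K * real m ^ (c + 1) * size_bound (i + 3) P n"
proof -
  let ?P = "\<lambda>j. P (j + 3)" and ?N = "cbrt n" and ?a = "cbrt (card (P 0))" and ?b = "cbrt (card (P (i + 3)))"
  have K: "0 \<le> K" using cb by (simp add: chain_bound_def)
  have "Ck (i + 3) \<delta> P \<le> 2 * (card (incidences (\<delta> 0) (P 0) (P 1)) * Ck i (\<lambda>j. \<delta> (j + 3)) ?P)"
    by (rule Ck_split_third) (rule admissibleD(2)[OF adm])
  then have "real (Ck (i + 3) \<delta> P) \<le> real (2 * (card (incidences (\<delta> 0) (P 0) (P 1)) * Ck i (\<lambda>j. \<delta> (j + 3)) ?P))"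
    by (simp only: of_nat_le_iff)
  also have "\<dots> = 2 * (real (card (incidences (\<delta> 0) (P 0) (P 1))) * real (Ck i (\<lambda>j. \<delta> (j + 3)) ?P))" by simp
  also have "\<dots> \<le> 2 * ((36 * real m * (?a * ?N ^ 2)) * (K * real m ^ c * (?N ^ fk i * ?N * ?b)))"
  proof (intro mult_left_mono mult_mono)
    show "real (card (incidences (\<delta> 0) (P 0) (P 1))) \<le> 36 * real m * (?a * ?N ^ 2)"
      using I le_cbrt_mult[OF admissibleD(3)[OF adm, of 0]]
      by (smt (verit) le0 mult_left_mono of_nat_0_le_iff)
    have "real (Ck i (\<lambda>j. \<delta> (j + 3)) ?P) \<le> K * real m ^ c * size_bound i ?P n"
      by (rule chain_boundD[OF cb admissible_tail[OF adm]])
    also have "\<dots> \<le> K * real m ^ c * (?N ^ fk i * ?N * ?b)"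
      unfolding size_bound_def using K admissibleD(7)[OF adm, of 3]
      by (intro mult_left_mono mult_right_mono) auto
    finally show "real (Ck i (\<lambda>j. \<delta> (j + 3)) ?P) \<le> K * real m ^ c * (?N ^ fk i * ?N * ?b)" .
  qed auto
  also have "\<dots> = 72 * K * real m ^ (c + 1) * size_bound (i + 3) P n"
    unfolding size_bound_def fk_add3 by (simp add: algebra_simps power_add power2_eq_square power3_eq_cube)
  finally show ?thesis .
qed

lemma Ck_bound_few_incidences_last:
  assumes cb: "chain_bound i K c" and adm: "admissible (i + 3) \<delta> P n m"
    and I: "real (card (incidences (\<delta> (i + 2)) (P (i + 3)) (P (i + 2)))) \<le> 36 * real m * real (card (P (i + 3)))"
  shows "real (Ck (i + 3) \<delta> P) \<le> 72 * K * real m ^ (c + 1) * size_bound (i + 3) P n"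
proof -
  have e: "i + 3 - Suc 0 = i + 2" "i + 3 - 0 = i + 3" "i + 3 - 1 = i + 2" by simp_all
  have "Ck (i + 3) (\<lambda>s. \<delta> (i + 3 - Suc s)) (\<lambda>s. P (i + 3 - s)) = Ck (i + 3) \<delta> P"
    by (rule Ck_reverse) (rule admissibleD(2)[OF adm])
  then show ?thesis
    using Ck_bound_few_incidences[OF cb admissible_reverse[OF adm]] I
    unfolding size_bound_reverse e by metis
qed

text \<open>The factor \<open>card (P 0)\<close> is left as it is because it is estimated
  differently for general and for small first sets. The extra \<open>cbrt n\<close> comes from the
  new first set.\<close>

lemma Ck_bound_second:
  assumes cb: "chain_bound i K c" and adm: "admissible (i + 2) \<delta> P n m"
  shows "real (Ck (i + 2) \<delta> P) \<le>
    2 * K * real m ^ c * (real (card (P 0)) * cbrt n ^ (fk i + 1) * cbrt (card (P (i + 2))))"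
proof -
  let ?P = "\<lambda>j. P (j + 2)" and ?N = "cbrt n" and ?b = "cbrt (card (P (i + 2)))"
  have K: "0 \<le> K" using cb by (simp add: chain_bound_def)
  have "Ck (i + 2) \<delta> P \<le> 2 * (card (P 0) * Ck i (\<lambda>j. \<delta> (j + 2)) ?P)"
    by (rule Ck_split_second) (rule admissibleD(2)[OF adm])
  then have "real (Ck (i + 2) \<delta> P) \<le> real (2 * (card (P 0) * Ck i (\<lambda>j. \<delta> (j + 2)) ?P))"
    by (simp only: of_nat_le_iff)
  also have "\<dots> = 2 * (real (card (P 0)) * real (Ck i (\<lambda>j. \<delta> (j + 2)) ?P))" by simp
  also have "\<dots> \<le> 2 * (real (card (P 0)) * (K * real m ^ c * (?N ^ fk i * ?N * ?b)))"
  proof (intro mult_left_mono)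
    have "real (Ck i (\<lambda>j. \<delta> (j + 2)) ?P) \<le> K * real m ^ c * size_bound i ?P n"
      by (rule chain_boundD[OF cb admissible_tail[OF adm]])
    also have "\<dots> \<le> K * real m ^ c * (?N ^ fk i * ?N * ?b)"
      unfolding size_bound_def using K admissibleD(7)[OF adm, of 2]
      by (intro mult_left_mono mult_right_mono) (auto simp: numeral_2_eq_2)
    finally show "real (Ck i (\<lambda>j. \<delta> (j + 2)) ?P) \<le> K * real m ^ c * (?N ^ fk i * ?N * ?b)" .
  qed auto
  finally show ?thesis by (simp add: algebra_simps)
qed

section \<open>Base cases and the induction step for each residue modulo 3\<close>

lemma chain_bound_0: "chain_bound 0 1 0"
  unfolding chain_bound_def
proof (intro conjI allI impI)
  fix \<delta> P n m assume adm: "admissible 0 \<delta> P n m"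
  have "Ck 0 \<delta> P \<le> card (P 0)" unfolding Ck_def
  proof (rule card_inj_on_le[of "\<lambda>p. p 0"])
    show "inj_on (\<lambda>p. p 0) (chain_tuples 0 \<delta> P)"
    proof (rule inj_onI)
      fix p q assume p: "p \<in> chain_tuples 0 \<delta> P" and q: "q \<in> chain_tuples 0 \<delta> P" and "p 0 = q 0"
      then show "p = q" using extensionalityI[OF chain_tuplesD(1)[OF p] chain_tuplesD(1)[OF q]] by simp
    qed
  qed (use adm chain_tuplesD(2) in \<open>auto simp: admissible_def\<close>)
  then have "real (Ck 0 \<delta> P) \<le> real (card (P 0))" by simp
  also have "\<dots> = cbrt (card (P 0)) * cbrt (card (P 0)) * cbrt (card (P 0))"
    using cbrt_cube[of "card (P 0)"] by (simp add: power3_eq_cube)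
  also have "\<dots> \<le> size_bound 0 P n"
    unfolding size_bound_def fk_def using admissibleD(7)[OF adm, of 0] by (auto intro!: mult_right_mono)
  finally show "real (Ck 0 \<delta> P) \<le> 1 * real m ^ 0 * size_bound 0 P n" by simp
qed simp

lemma chain_bound_1: "chain_bound 1 36 1"
  unfolding chain_bound_def
proof (intro conjI allI impI)
  fix \<delta> P n m assume adm: "admissible 1 \<delta> P n m"
  define a b N where "a = cbrt (card (P 0))" and "b = cbrt (card (P 1))" and "N = cbrt n"
  let ?I = "incidences (\<delta> 0) (P 0) (P 1)"
  have fI: "finite ?I" unfolding incidences_def
    by (rule finite_subset[of _ "P 0 \<times> P 1"]) (use admissibleD(2)[OF adm] in auto)
  have "Ck 1 \<delta> P \<le> card ?I" unfolding Ck_def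
  proof (rule card_inj_on_le[of "\<lambda>p. (p 0, p 1)"])
    show "inj_on (\<lambda>p. (p 0, p 1)) (chain_tuples 1 \<delta> P)"
    proof (rule inj_onI)
      fix p q assume p: "p \<in> chain_tuples 1 \<delta> P" and q: "q \<in> chain_tuples 1 \<delta> P" and eq: "(p 0, p 1) = (q 0, q 1)"
      show "p = q"
      proof (rule extensionalityI[OF chain_tuplesD(1)[OF p] chain_tuplesD(1)[OF q]])
        fix i :: nat assume "i \<in> {0..1}"
        then have "i = 0 \<or> i = 1" by auto
        then show "p i = q i" using eq by auto
      qed
    qed
    show "(\<lambda>p. (p 0, p 1)) ` chain_tuples 1 \<delta> P \<subseteq> ?I"
    proof (rule image_subsetI)
      fix p assume p: "p \<in> chain_tuples 1 \<delta> P"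
      show "(p 0, p 1) \<in> ?I"
        using chain_tuplesD(2)[OF p, of 0] chain_tuplesD(2)[OF p, of 1] chain_tuplesD(3)[OF p, of 0]
        by (auto simp: incidences_def)
    qed
  qed (rule fI)
  then have le: "real (Ck 1 \<delta> P) \<le> real (card ?I)" by simp
  show "real (Ck 1 \<delta> P) \<le> 36 * real m ^ 1 * size_bound 1 P n"
  proof (cases "P 0 = {} \<or> P 1 = {}")
    case True
    then have "?I = {}" unfolding incidences_def by auto
    then have "real (Ck 1 \<delta> P) \<le> 0" using le by simp
    also have "0 \<le> 36 * real m ^ 1 * size_bound 1 P n" by simp
    finally show ?thesis .
  next
    case False
    \<comment> \<open>The terms a^3 and b^3 are dominated by N^2 a b only when both end sets are
      nonempty.\<close>
    then have ab: "1 \<le> a" "1 \<le> b" unfolding a_def b_def using admissibleD(2)[OF adm]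
      by (auto intro!: cbrt_ge_one simp: Suc_le_eq card_gt_0_iff)
    have N: "a \<le> N" "b \<le> N" unfolding a_def b_def N_def using admissibleD(7)[OF adm] by auto
    have "real (card ?I) \<le> 12 * real m * ((a * b) ^ 2 + a ^ 3 + b ^ 3)"
      unfolding a_def b_def using admissibleD[OF adm] by (intro card_incidences_le_cbrt) auto
    moreover have "(a * b) ^ 2 \<le> N ^ 2 * a * b"
    proof -
      have "(a * b) * (a * b) \<le> (N * N) * (a * b)" using ab N by (intro mult_right_mono mult_mono) auto
      then show ?thesis by (simp add: power2_eq_square algebra_simps)
    qed
    moreover have "a ^ 3 \<le> N ^ 2 * a * b"
    proof -
      have "(a * a) * a * 1 \<le> (N * N) * a * b" using ab N by (intro mult_right_mono mult_mono) auto
      then show ?thesis by (simp add: power2_eq_square power3_eq_cube)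
    qed
    moreover have "b ^ 3 \<le> N ^ 2 * a * b"
    proof -
      have "(b * b) * 1 * b \<le> (N * N) * a * b" using ab N by (intro mult_right_mono mult_mono) auto
      then show ?thesis by (simp add: power2_eq_square power3_eq_cube)
    qed
    ultimately have "(a * b) ^ 2 + a ^ 3 + b ^ 3 \<le> 3 * (N ^ 2 * a * b)" "real (card ?I) \<le> 12 * real m * ((a * b) ^ 2 + a ^ 3 + b ^ 3)" by linarith+
    then have "real (card ?I) \<le> 12 * real m * (3 * (N ^ 2 * a * b))"
      by (smt (verit) mult_left_mono of_nat_0_le_iff mult_nonneg_nonneg)
    also have "\<dots> = 36 * real m ^ 1 * size_bound 1 P n"
      unfolding size_bound_def fk_def a_def b_def N_def by (simp add: power2_eq_square)
    finally show ?thesis using le by linarith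
  qed
qed simp

text \<open>Here \<open>fk\<close> grows by 3 from \<open>i\<close> to \<open>i + 2\<close>, which
  pays for leaving out the second point with the crude bound on the first set.\<close>

lemma chain_bound_step_2:
  assumes "i mod 3 = 0" and cb: "chain_bound i K c"
  shows "chain_bound (i + 2) (2 * K) c"
  unfolding chain_bound_def
proof (intro conjI allI impI)
  show K: "0 \<le> 2 * K" using cb by (simp add: chain_bound_def)
  fix \<delta> P n m assume adm: "admissible (i + 2) \<delta> P n m"
  have f: "fk (i + 2) = fk i + 3" using assms(1) by (auto simp: fk_def mod_Suc)
  let ?N = "cbrt n" and ?a = "cbrt (card (P 0))" and ?b = "cbrt (card (P (i + 2)))"
  have "real (card (P 0)) * ?N ^ (fk i + 1) * ?b \<le> (?a * ?N ^ 2) * ?N ^ (fk i + 1) * ?b"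
    using le_cbrt_mult[OF admissibleD(3)[OF adm, of 0]] by (intro mult_right_mono) auto
  also have "\<dots> = size_bound (i + 2) P n"
    unfolding size_bound_def f by (simp add: power_add power2_eq_square power3_eq_cube)
  finally have "2 * K * real m ^ c * (real (card (P 0)) * ?N ^ (fk i + 1) * ?b)
      \<le> 2 * K * real m ^ c * size_bound (i + 2) P n"
    using K by (intro mult_left_mono) auto
  then show "real (Ck (i + 2) \<delta> P) \<le> 2 * K * real m ^ c * size_bound (i + 2) P n"
    using Ck_bound_second[OF cb adm] by linarith
qed

lemma degree_less_rich: "q \<in> rich d A B j \<Longrightarrow> degree d A q \<le> 2 ^ Suc j"
  by (simp add: rich_def)

lemma degree_ge_rich: "q \<in> rich d A B j \<Longrightarrow> 2 ^ j \<le> degree d A q"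
  by (simp add: rich_def)

text \<open>Apply the dichotomy to each dyadic class \<open>B\<close> of the second set with E =
  \<open>cbrt n * cbrt (card (P 0))\<close>. With few incidences, skip to the fourth point.
  Otherwise drop the first point at the cost \<open>2 ^ Suc j\<close>; the remaining chain starts in
  \<open>B\<close>, and the factor \<open>cbrt n\<close> in E is exactly the growth of
  \<open>fk\<close> from \<open>i + 2\<close> to \<open>i + 3\<close>.\<close>

lemma chain_bound_step_1:
  assumes "i mod 3 = 1" and cb: "chain_bound i K c" and cb': "chain_bound (i + 2) K c"
  shows "chain_bound (i + 3) (144 * K) (c + 2)"
  unfolding chain_bound_def
proof (intro conjI allI impI)
  have K: "0 \<le> K" using cb by (simp add: chain_bound_def)
  then show "0 \<le> 144 * K" by simp
  fix \<delta> P n m assume adm: "admissible (i + 3) \<delta> P n m"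
  have "(i + 3) mod 3 = 1" "(i + 2) mod 3 = 0" using assms(1) by presburger+
  then have f: "fk (i + 3) = fk (i + 2) + 1" by (simp add: fk_def)
  let ?T = "size_bound (i + 3) P n"
  have m: "1 \<le> real m" using admissibleD(5)[OF adm] by simp
  have cls: "real (Ck (i + 3) \<delta> (P(1 := rich (\<delta> 0) (P 0) (P 1) j))) \<le> 72 * K * real m ^ (c + 1) * ?T" for j
  proof -
    define B where "B = rich (\<delta> 0) (P 0) (P 1) j"
    define P' where "P' = P(1 := B)"
    have adm': "admissible (i + 3) \<delta> P' n m"
      unfolding P'_def B_def using adm by (rule admissible_update) (auto simp: rich_subset)
    have P': "P' 0 = P 0" "P' 1 = B" "P' (i + 3) = P (i + 3)" unfolding P'_def by auto
    have T: "size_bound (i + 3) P' n = ?T" unfolding size_bound_def P' ..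
    let ?N = "cbrt n" and ?a = "cbrt (card (P 0))" and ?b = "cbrt (card (P (i + 3)))"
    have "real (card (incidences (\<delta> 0) (P 0) B)) \<le> 36 * real m * real (card (P 0)) \<or>
        real (2 ^ j) * cbrt (card B) \<le> 36 * real m * (?N * ?a)"
    proof (rule rich_dichotomy)
      show "2 ^ j \<le> degree (\<delta> 0) (P 0) q" if "q \<in> B" for q using that unfolding B_def by (rule degree_ge_rich)
      assume "0 < card (P 0)"
      then have a: "1 \<le> ?a" by (intro cbrt_ge_one) simp
      have "?N * 1 \<le> ?N * ?a" using a by (intro mult_left_mono) auto
      moreover have "cbrt (card B) \<le> ?N" using admissibleD(7)[OF adm', of 1] P' by simp
      moreover have "?a * ?a \<le> ?N * ?a" using admissibleD(7)[OF adm, of 0] by (intro mult_right_mono) auto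
      ultimately show "cbrt (card B) \<le> ?N * ?a \<and> ?a ^ 2 \<le> ?N * ?a" by (simp add: power2_eq_square)
    qed (use admissibleD(1)[OF adm, of 0] admissibleD(2,6)[OF adm', of 0] admissibleD(2,6)[OF adm', of 1]
        admissibleD(5)[OF adm] P' in auto)
    then show ?thesis
    proof
      assume "real (card (incidences (\<delta> 0) (P 0) B)) \<le> 36 * real m * real (card (P 0))"
      then show ?thesis using Ck_bound_few_incidences[OF cb adm'] P' T unfolding P'_def B_def by simp
    next
      assume r: "real (2 ^ j) * cbrt (card B) \<le> 36 * real m * (?N * ?a)"
      let ?C = "Ck (i + 2) (\<lambda>j. \<delta> (j + 1)) (\<lambda>j. P' (j + 1))"
      have "Ck (Suc (i + 2)) \<delta> P' \<le> 2 ^ Suc j * ?C"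
      proof (rule Ck_drop_first)
        show "card {p \<in> P' 0. dist p q = \<delta> 0} \<le> 2 ^ Suc j" if "q \<in> P' 1" for q
          using degree_less_rich[of q "\<delta> 0" "P 0" "P 1" j] that unfolding P' B_def degree_def .
      qed (use admissibleD(2)[OF adm'] in auto)
      then have "real (Ck (i + 3) \<delta> P') \<le> real (2 ^ Suc j * ?C)"
        by (simp only: of_nat_le_iff) (simp add: numeral_2_eq_2 numeral_3_eq_3)
      also have "\<dots> = 2 * real (2 ^ j) * real ?C" by simp
      also have "\<dots> \<le> 2 * real (2 ^ j) * (K * real m ^ c * (?N ^ fk (i + 2) * cbrt (card B) * ?b))"
      proof (rule mult_left_mono)
        have "admissible (i + 2) (\<lambda>j. \<delta> (j + 1)) (\<lambda>j. P' (j + 1)) n m"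
          using adm' by (intro admissible_tail) (simp add: numeral_2_eq_2 numeral_3_eq_3)
        from chain_boundD[OF cb' this]
        show "real ?C \<le> K * real m ^ c * (?N ^ fk (i + 2) * cbrt (card B) * ?b)"
          unfolding size_bound_def using P' by (simp add: numeral_2_eq_2 numeral_3_eq_3)
      qed simp
      also have "\<dots> = 2 * K * real m ^ c * ?N ^ fk (i + 2) * ?b * (real (2 ^ j) * cbrt (card B))"
        by (simp only: ac_simps)
      also have "\<dots> \<le> 2 * K * real m ^ c * ?N ^ fk (i + 2) * ?b * (36 * real m * (?N * ?a))"
        using K by (intro mult_left_mono r) auto
      also have "\<dots> = 72 * K * real m ^ (c + 1) * ?T"
        unfolding size_bound_def f by (simp add: algebra_simps)
      finally show ?thesis unfolding P'_def B_def .
    qed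
  qed
  have "Ck (i + 3) \<delta> P \<le> (\<Sum>j\<le>m. Ck (i + 3) \<delta> (P(1 := rich (\<delta> 0) (P 0) (P 1) j)))"
    using chain_tuplesD(3)[of _ "i + 3" \<delta> P 0] by (intro Ck_le_sum_rich[OF adm]) auto
  then have "real (Ck (i + 3) \<delta> P) \<le> real (\<Sum>j\<le>m. Ck (i + 3) \<delta> (P(1 := rich (\<delta> 0) (P 0) (P 1) j)))"
    by (simp only: of_nat_le_iff)
  also have "\<dots> \<le> of_nat (card {..m}) * (72 * K * real m ^ (c + 1) * ?T)"
    unfolding of_nat_sum by (rule sum_bounded_above) (rule cls)
  \<comment> \<open>There are \<open>m + 1\<close> classes, and \<open>m\<close> is at least
    1.\<close>
  also have "\<dots> \<le> (2 * real m) * (72 * K * real m ^ (c + 1) * ?T)"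
    using m K by (intro mult_right_mono) auto
  also have "\<dots> = 144 * K * real m ^ (c + 2) * ?T" by (simp add: algebra_simps)
  finally show "real (Ck (i + 3) \<delta> P) \<le> 144 * K * real m ^ (c + 2) * ?T" .
qed

text \<open>Leaving out the second point costs \<open>card (P 0) * cbrt n\<close>. For a small first
  set this is at most \<open>cbrt (card (P 0)) * cbrt n ^ 2\<close>, and \<open>fk\<close> grows by
  exactly 2 from \<open>i + 1\<close> to \<open>i + 3\<close>.\<close>

lemma Ck_bound_small_first:
  assumes "i mod 3 = 0" and cb: "chain_bound (i + 1) K c" and adm: "admissible (i + 3) \<delta> P n m"
    and small: "cbrt (card (P 0)) ^ 2 \<le> cbrt n"
  shows "real (Ck (i + 3) \<delta> P) \<le> 2 * K * real m ^ c * size_bound (i + 3) P n"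
proof -
  have K: "0 \<le> K" using cb by (simp add: chain_bound_def)
  have f: "fk (i + 3) = fk (i + 1) + 2" using assms(1) by (rule fk_add3_eq)
  let ?N = "cbrt n" and ?a = "cbrt (card (P 0))" and ?b = "cbrt (card (P (i + 3)))"
  have "real (card (P 0)) = ?a * ?a ^ 2"
    using cbrt_cube[of "card (P 0)"] by (simp add: power2_eq_square power3_eq_cube)
  also have "\<dots> \<le> ?a * ?N" by (intro mult_left_mono small) simp
  finally have "real (card (P 0)) * ?N ^ (fk (i + 1) + 1) * ?b \<le> (?a * ?N) * ?N ^ (fk (i + 1) + 1) * ?b"
    by (intro mult_right_mono) auto
  also have "\<dots> = size_bound (i + 3) P n" unfolding size_bound_def f by (simp add: power_add power2_eq_square)
  finally have "2 * K * real m ^ c * (real (card (P 0)) * ?N ^ (fk (i + 1) + 1) * ?b)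
      \<le> 2 * K * real m ^ c * size_bound (i + 3) P n"
    using K by (intro mult_left_mono) auto
  moreover have e: "i + 1 + 2 = i + 3" by simp
  ultimately show ?thesis using Ck_bound_second[OF cb, of \<delta> P n m] adm unfolding e by linarith
qed

text \<open>Here \<open>fk (i + 3) = fk (i + 2)\<close>, so dropping one end point gains no power of
  \<open>n\<close>; dropping both leaves a chain of \<open>i + 1\<close> steps and gains two factors
  \<open>cbrt n\<close>. Since both end sets are large, the dichotomy applies with E the square of
  the cube root of the end size: it already dominates \<open>cbrt n\<close>. If either end spans few
  incidences, that end alone suffices.\<close>

lemma Ck_bound_both_rich:
  assumes "i mod 3 = 0" and cb: "chain_bound i K c" and cb': "chain_bound (i + 1) K c"
    and adm: "admissible (i + 3) \<delta> P n m"
    and large: "cbrt n \<le> cbrt (card (P 0)) ^ 2" "cbrt n \<le> cbrt (card (P (i + 3))) ^ 2"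
    and lo: "\<And>q. q \<in> P 1 \<Longrightarrow> 2 ^ j \<le> degree (\<delta> 0) (P 0) q"
      "\<And>q. q \<in> P (i + 2) \<Longrightarrow> 2 ^ l \<le> degree (\<delta> (i + 2)) (P (i + 3)) q"
    and hi: "\<And>q. q \<in> P 1 \<Longrightarrow> degree (\<delta> 0) (P 0) q \<le> 2 ^ Suc j"
      "\<And>q. q \<in> P (i + 2) \<Longrightarrow> degree (\<delta> (i + 2)) (P (i + 3)) q \<le> 2 ^ Suc l"
  shows "real (Ck (i + 3) \<delta> P) \<le> 5184 * K * real m ^ (c + 2) * size_bound (i + 3) P n"
proof -
  have K: "0 \<le> K" using cb by (simp add: chain_bound_def)
  have f: "fk (i + 3) = fk (i + 1) + 2" using assms(1) by (rule fk_add3_eq)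
  have m: "1 \<le> real m" using admissibleD(5)[OF adm] by simp
  let ?T = "size_bound (i + 3) P n"
  have weak: "72 * K * real m ^ (c + 1) * ?T \<le> 5184 * K * real m ^ (c + 2) * ?T"
    using K m by (intro mult_right_mono mult_mono power_increasing) auto
  let ?N = "cbrt n" and ?a = "cbrt (card (P 0))" and ?b = "cbrt (card (P (i + 3)))"
  let ?u = "cbrt (card (P 1))" and ?v = "cbrt (card (P (i + 2)))"
  have di: "real (card (incidences (\<delta> 0) (P 0) (P 1))) \<le> 36 * real m * real (card (P 0)) \<or>
      real (2 ^ j) * ?u \<le> 36 * real m * ?a ^ 2"
    by (rule rich_dichotomy) (use lo(1) admissibleD[OF adm] large(1) order_trans[OF admissibleD(7)[OF adm]] in auto)
  have di': "real (card (incidences (\<delta> (i + 2)) (P (i + 3)) (P (i + 2)))) \<le> 36 * real m * real (card (P (i + 3))) \<or>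
      real (2 ^ l) * ?v \<le> 36 * real m * ?b ^ 2"
    by (rule rich_dichotomy) (use lo(2) admissibleD[OF adm] large(2) order_trans[OF admissibleD(7)[OF adm]] in auto)
  consider "real (card (incidences (\<delta> 0) (P 0) (P 1))) \<le> 36 * real m * real (card (P 0))"
    | "real (card (incidences (\<delta> (i + 2)) (P (i + 3)) (P (i + 2)))) \<le> 36 * real m * real (card (P (i + 3)))"
    | "real (2 ^ j) * ?u \<le> 36 * real m * ?a ^ 2" "real (2 ^ l) * ?v \<le> 36 * real m * ?b ^ 2"
    using di di' by blast
  then show ?thesis
  proof cases
    case 1
    from Ck_bound_few_incidences[OF cb adm this] weak show ?thesis by linarith
  next
    case 2
    from Ck_bound_few_incidences_last[OF cb adm this] weak show ?thesis by linarith
  next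
    case 3
    let ?\<delta> = "\<lambda>s. \<delta> (s + 1)" and ?P = "\<lambda>s. P (s + 1)"
    have e: "Suc (i + 2) = i + 3" "Suc (i + 1) = i + 2" "i + 1 + 1 = i + 2" by simp_all
    have adm1: "admissible (i + 2) ?\<delta> ?P n m"
      using admissible_tail[of "i + 2" 1 \<delta> P n m] adm by (simp add: numeral_2_eq_2 numeral_3_eq_3)
    then have adm2: "admissible (i + 1) ?\<delta> ?P n m"
      using admissible_init[of "i + 1"] by simp
    have first: "Ck (Suc (i + 2)) \<delta> P \<le> 2 ^ Suc j * Ck (i + 2) ?\<delta> ?P"
      by (rule Ck_drop_first) (use hi(1) admissibleD(2)[OF adm] in \<open>auto simp: degree_def\<close>)
    have "Ck (Suc (i + 1)) ?\<delta> ?P \<le> 2 ^ Suc l * Ck (i + 1) ?\<delta> ?P"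
    proof (rule Ck_drop_last)
      show "finite (?P s)" if "s \<le> Suc (i + 1)" for s using admissibleD(2)[OF adm] that by simp
      show "card {p \<in> ?P (Suc (i + 1)). dist p q = ?\<delta> (i + 1)} \<le> 2 ^ Suc l" if "q \<in> ?P (i + 1)" for q
        using hi(2)[of q] that unfolding degree_def by (simp add: numeral_2_eq_2 numeral_3_eq_3)
    qed
    then have "Ck (i + 3) \<delta> P \<le> 2 ^ Suc j * (2 ^ Suc l * Ck (i + 1) ?\<delta> ?P)"
      using first unfolding e by (meson le_trans mult_le_mono2)
    then have "real (Ck (i + 3) \<delta> P) \<le> real (2 ^ Suc j * (2 ^ Suc l * Ck (i + 1) ?\<delta> ?P))"
      by (simp only: of_nat_le_iff)
    also have "\<dots> = 4 * real (2 ^ j) * real (2 ^ l) * real (Ck (i + 1) ?\<delta> ?P)" by simp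
    also have "\<dots> \<le> 4 * real (2 ^ j) * real (2 ^ l) * (K * real m ^ c * (?N ^ fk (i + 1) * ?u * ?v))"
    proof (rule mult_left_mono)
      show "real (Ck (i + 1) ?\<delta> ?P) \<le> K * real m ^ c * (?N ^ fk (i + 1) * ?u * ?v)"
        using chain_boundD[OF cb' adm2] unfolding size_bound_def by (simp add: numeral_2_eq_2)
    qed simp
    also have "\<dots> = 4 * K * real m ^ c * ?N ^ fk (i + 1) * ((real (2 ^ j) * ?u) * (real (2 ^ l) * ?v))"
      by (simp only: ac_simps)
    \<comment> \<open>One of the two cube roots in each squared end factor is traded for
      \<open>cbrt n\<close>, as the final bound has only the first power of each.\<close>
    also have "\<dots> \<le> 4 * K * real m ^ c * ?N ^ fk (i + 1) * ((36 * real m * (?N * ?a)) * (36 * real m * (?N * ?b)))"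
    proof (rule mult_left_mono[OF mult_mono])
      have "?a * ?a \<le> ?N * ?a" "?b * ?b \<le> ?N * ?b"
        using admissibleD(7)[OF adm] by (auto intro!: mult_right_mono)
      then have "36 * real m * ?a ^ 2 \<le> 36 * real m * (?N * ?a)" "36 * real m * ?b ^ 2 \<le> 36 * real m * (?N * ?b)"
        by (auto simp: power2_eq_square intro!: mult_left_mono)
      then show "real (2 ^ j) * ?u \<le> 36 * real m * (?N * ?a)" "real (2 ^ l) * ?v \<le> 36 * real m * (?N * ?b)"
        using 3 by linarith+
    qed (use K in auto)
    also have "\<dots> = 5184 * K * real m ^ (c + 2) * ?T"
      unfolding size_bound_def f by (simp add: algebra_simps power_add power2_eq_square)
    finally show ?thesis .
  qed
qed

text \<open>Small end sets are handled directly, at the far end by reversal. Otherwise the second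
  and the last but one sets are both split dyadically; the at most \<open>4 * m\<^sup>2\<close>
  pairs of classes explain the constant and two of the four extra powers of
  \<open>m\<close>.\<close>

lemma chain_bound_step_0:
  assumes "i mod 3 = 0" and cb: "chain_bound i K c" and cb': "chain_bound (i + 1) K c"
  shows "chain_bound (i + 3) (20736 * K) (c + 4)"
  unfolding chain_bound_def
proof (intro conjI allI impI)
  have K: "0 \<le> K" using cb by (simp add: chain_bound_def)
  then show "0 \<le> 20736 * K" by simp
  fix \<delta> P n m assume adm: "admissible (i + 3) \<delta> P n m"
  have m: "1 \<le> real m" using admissibleD(5)[OF adm] by simp
  let ?T = "size_bound (i + 3) P n"
  have weak: "2 * K * real m ^ c * ?T \<le> 20736 * K * real m ^ (c + 4) * ?T"
    using K m by (intro mult_right_mono mult_mono power_increasing) auto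
  consider "cbrt (card (P 0)) ^ 2 \<le> cbrt n" | "cbrt (card (P (i + 3))) ^ 2 \<le> cbrt n"
    | "cbrt n \<le> cbrt (card (P 0)) ^ 2" "cbrt n \<le> cbrt (card (P (i + 3))) ^ 2" by linarith
  then show "real (Ck (i + 3) \<delta> P) \<le> 20736 * K * real m ^ (c + 4) * ?T"
  proof cases
    case 1
    from Ck_bound_small_first[OF assms(1) cb' adm this] weak show ?thesis by linarith
  next
    case 2
    then have "real (Ck (i + 3) (\<lambda>s. \<delta> (i + 3 - Suc s)) (\<lambda>s. P (i + 3 - s)))
        \<le> 2 * K * real m ^ c * size_bound (i + 3) (\<lambda>s. P (i + 3 - s)) n"
      by (intro Ck_bound_small_first[OF assms(1) cb' admissible_reverse[OF adm]]) simp
    moreover have "Ck (i + 3) (\<lambda>s. \<delta> (i + 3 - Suc s)) (\<lambda>s. P (i + 3 - s)) = Ck (i + 3) \<delta> P"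
      by (rule Ck_reverse) (rule admissibleD(2)[OF adm])
    ultimately have "real (Ck (i + 3) \<delta> P) \<le> 2 * K * real m ^ c * ?T"
      unfolding size_bound_reverse by simp
    with weak show ?thesis by linarith
  next
    case 3
    define Q where "Q j = P(1 := rich (\<delta> 0) (P 0) (P 1) j)" for j
    \<comment> \<open>The positions 1 and \<open>i + 2\<close> differ even for \<open>i = 0\<close>,
      so the second refinement leaves the first untouched, and both degrees are measured in the
      original end sets.\<close>
    define R where "R j l = (Q j)(i + 2 := rich (\<delta> (i + 2)) (Q j (i + 3)) (Q j (i + 2)) l)" for j l
    have admQ: "admissible (i + 3) \<delta> (Q j) n m" for j
      unfolding Q_def using adm by (rule admissible_update) (auto simp: rich_subset)
    have admR: "admissible (i + 3) \<delta> (R j l) n m" for j l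
      unfolding R_def using admQ by (rule admissible_update) (auto simp: rich_subset)
    have R: "R j l 0 = P 0" "R j l (i + 3) = P (i + 3)" for j l
      unfolding R_def Q_def by auto
    have R1: "R j l 1 \<subseteq> rich (\<delta> 0) (P 0) (P 1) j" for j l
      unfolding R_def Q_def using rich_subset by auto
    have R2: "R j l (i + 2) \<subseteq> rich (\<delta> (i + 2)) (P (i + 3)) (Q j (i + 2)) l" for j l
      unfolding R_def by (auto simp: Q_def)
    have cls: "real (Ck (i + 3) \<delta> (R j l)) \<le> 5184 * K * real m ^ (c + 2) * ?T" for j l
    proof -
      have "real (Ck (i + 3) \<delta> (R j l)) \<le> 5184 * K * real m ^ (c + 2) * size_bound (i + 3) (R j l) n"
        using 3 R1[of j l] R2[of j l]
        by (intro Ck_bound_both_rich[OF assms admR, where j = j and l = l])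
          (auto simp only: R intro: degree_ge_rich degree_less_rich)
      then show ?thesis unfolding size_bound_def R .
    qed
    have "Ck (i + 3) \<delta> P \<le> (\<Sum>j\<le>m. Ck (i + 3) \<delta> (Q j))"
      unfolding Q_def using chain_tuplesD(3)[of _ "i + 3" \<delta> P 0] by (intro Ck_le_sum_rich[OF adm]) auto
    also have "\<dots> \<le> (\<Sum>j\<le>m. \<Sum>l\<le>m. Ck (i + 3) \<delta> (R j l))"
    proof (rule sum_mono)
      fix j
      show "Ck (i + 3) \<delta> (Q j) \<le> (\<Sum>l\<le>m. Ck (i + 3) \<delta> (R j l))"
        unfolding R_def
      proof (rule Ck_le_sum_rich[OF admQ])
        fix p assume "p \<in> chain_tuples (i + 3) \<delta> (Q j)"
        then have "dist (p (i + 2)) (p (Suc (i + 2))) = \<delta> (i + 2)" by (rule chain_tuplesD(3)) simp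
        then show "dist (p (i + 3)) (p (i + 2)) = \<delta> (i + 2)"
          by (simp add: dist_commute numeral_2_eq_2 numeral_3_eq_3)
      qed auto
    qed
    finally have "real (Ck (i + 3) \<delta> P) \<le> real (\<Sum>j\<le>m. \<Sum>l\<le>m. Ck (i + 3) \<delta> (R j l))"
      by (simp only: of_nat_le_iff)
    also have "\<dots> \<le> of_nat (card {..m}) * (of_nat (card {..m}) * (5184 * K * real m ^ (c + 2) * ?T))"
      unfolding of_nat_sum by (intro sum_bounded_above cls)
    also have "\<dots> \<le> (2 * real m) * ((2 * real m) * (5184 * K * real m ^ (c + 2) * ?T))"
      using m K by (intro mult_mono) auto
    also have "\<dots> = 20736 * K * real m ^ (c + 4) * ?T" by (simp add: algebra_simps power_add power2_eq_square eval_nat_numeral)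
    finally show ?thesis .
  qed
qed

text \<open>The induction is strong: residue 2 uses k - 2, residue 1 uses k - 3 and k - 1, and
  residue 0 uses k - 3 and k - 2. Where two bounds are used, taking maxima gives them common
  constants.\<close>

lemma exists_chain_bound: "\<exists>K c. chain_bound k K c"
proof (induction k rule: less_induct)
  case (less k)
  consider "k = 0" | "k = 1" | "k \<ge> 2" "k mod 3 = 2" | "k \<ge> 3" "k mod 3 = 1" | "k \<ge> 3" "k mod 3 = 0"
  proof -
    have "k mod 3 < 3" by simp
    then have "k mod 3 = 0 \<or> k mod 3 = 1 \<or> k mod 3 = 2" by linarith
    moreover have "k = 0 \<or> k = 1 \<or> k = 2 \<or> k \<ge> 3" by linarith
    ultimately show ?thesis using that by fastforce
  qed
  then show ?case
  proof cases
    case 1 then show ?thesis using chain_bound_0 by blast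
  next
    case 2 then show ?thesis using chain_bound_1 by blast
  next
    case 3
    then obtain i where i: "k = i + 2" using le_Suc_ex by (metis add.commute)
    then have "i mod 3 = 0" using 3 by presburger
    moreover obtain K c where "chain_bound i K c" using less[of i] i by auto
    ultimately have "chain_bound (i + 2) (2 * K) c" by (rule chain_bound_step_2)
    then show ?thesis using i by blast
  next
    case 4
    then obtain i where i: "k = i + 3" using le_Suc_ex by (metis add.commute)
    then have im: "i mod 3 = 1" using 4 by simp
    obtain K c K' c' where cb: "chain_bound i K c" "chain_bound (i + 2) K' c'"
      using less[of i] less[of "i + 2"] i by auto
    have "chain_bound i (max K K') (max c c')" "chain_bound (i + 2) (max K K') (max c c')"
      by (rule chain_bound_mono[OF cb(1)] chain_bound_mono[OF cb(2)]; simp)+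
    from chain_bound_step_1[OF im this] show ?thesis using i by blast
  next
    case 5
    then obtain i where i: "k = i + 3" using le_Suc_ex by (metis add.commute)
    then have im: "i mod 3 = 0" using 5 by simp
    obtain K c K' c' where cb: "chain_bound i K c" "chain_bound (i + 1) K' c'"
      using less[of i] less[of "i + 1"] i by auto
    have "chain_bound i (max K K') (max c c')" "chain_bound (i + 1) (max K K') (max c c')"
      by (rule chain_bound_mono[OF cb(1)] chain_bound_mono[OF cb(2)]; simp)+
    from chain_bound_step_0[OF im this] show ?thesis using i by blast
  qed
qed

section \<open>Translation into real exponents and natural logarithms\<close>

theorem theorem3p3:
  fixes k :: nat and \<delta> :: "nat \<Rightarrow> real" and x y :: real
  assumes "\<forall>i<k. \<delta> i > 0"
    and "0 \<le> x" "x \<le> 1" "0 \<le> y" "y \<le> 1"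
    and "k = 0 \<longrightarrow> x = y"
  shows "\<exists>c C. c > 0 \<and> C > 0 \<and>
           (\<forall>\<^sub>F n in sequentially.
              Ck_max k \<delta> (sizes k x y n) / real n powr ((real (fk k) + x + y) / 3)
                \<le> C * ln (real n) powr c)"
proof -
  obtain K0 c0 where "chain_bound k K0 c0" using exists_chain_bound by blast
  \<comment> \<open>Raising both constants to at least 1 makes them positive, as the conclusion
    demands.\<close>
  then have cb: "chain_bound k (max K0 1) (max c0 1)" by (rule chain_bound_mono) auto
  define K c where "K = max K0 1" and "c = max c0 1"
  have K: "1 \<le> K" and c: "1 \<le> c" unfolding K_def c_def by auto
  have bound: "Ck_max k \<delta> (sizes k x y n) / real n powr ((real (fk k) + x + y) / 3)
      \<le> K * 4 ^ c * ln (real n) powr real c" if n: "n \<ge> 2" for n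
  proof -
    \<comment> \<open>This is the least exponent with \<open>n \<le> 2 ^ m\<close>. For
      \<open>n\<close> at least 2 the rounding at most doubles the logarithm, and passing to
      \<open>ln\<close> costs another factor 2 because \<open>ln 2\<close> is at least 1/2.\<close>
    define m where "m = nat \<lceil>log 2 (real n)\<rceil>"
    have l1: "1 \<le> log 2 (real n)" using n by (simp add: le_log_iff)
    have m1: "1 \<le> m" and ml: "log 2 (real n) \<le> real m" and mu: "real m \<le> log 2 (real n) + 1"
      using l1 unfolding m_def by linarith+
    have "real n \<le> 2 powr real m" using ml n by (simp add: log_le_iff)
    then have "real n \<le> real (2 ^ m)" by (simp add: powr_realpow)
    then have nm: "n \<le> 2 ^ m" by (simp only: of_nat_le_iff)
    have ln2: "ln (2::real) \<ge> 1 / 2" by (subst ln_ge_iff) (simp_all add: exp_half_le2)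
    have "real m \<le> 2 * log 2 (real n)" using mu l1 by linarith
    also have "\<dots> \<le> 4 * ln (real n)"
    proof -
      have "ln (real n) * 1 \<le> ln (real n) * (2 * ln 2)" using ln2 n by (intro mult_left_mono) auto
      then show ?thesis by (simp add: log_def divide_le_eq mult.commute mult.left_commute)
    qed
    finally have m4: "real m \<le> 4 * ln (real n)" .
    define s where "s = (real (fk k) + x + y) / 3"
    have le: "real (Ck k \<delta> P) \<le> K * (4 * ln (real n)) ^ c * real n powr s"
      if P: "\<forall>i\<le>k. finite (P i) \<and> real (card (P i)) \<le> sizes k x y n i" for P
    proof -
      have n1: "1 \<le> real n" using n by simp
      have sz: "sizes k x y n i \<le> real n" for i
        using assms n powr_mono[of x 1 "real n"] powr_mono[of y 1 "real n"] unfolding sizes_def by auto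
      have "card (P i) \<le> n" if "i \<le> k" for i
      proof -
        have "real (card (P i)) \<le> real n" using P that sz[of i] by force
        then show ?thesis by simp
      qed
      then have adm: "admissible k \<delta> P n m"
        unfolding admissible_def using assms(1) P nm m1 by auto
      have root: "cbrt j \<le> real n powr (t / 3)" if "real j \<le> real n powr t" for j t
      proof -
        have "cbrt j \<le> root 3 (real n powr t)" unfolding cbrt_def using that by simp
        also have "\<dots> = real n powr (t / 3)"
          using n by (subst root_powr_inverse) (auto simp: powr_powr)
        finally show ?thesis .
      qed
      have c0: "real (card (P 0)) \<le> real n powr x" using P by (auto simp: sizes_def)
      \<comment> \<open>For \<open>k = 0\<close> the two ends are the same set, whose size is given
        by \<open>x\<close>; this is where \<open>x = y\<close> enters.\<close>
      have "sizes k x y n k = real n powr y" using assms(6) unfolding sizes_def by auto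
      then have ck: "real (card (P k)) \<le> real n powr y" using P by auto
      have "cbrt n ^ fk k \<le> (real n powr (1 / 3)) ^ fk k" using n by (intro power_mono root) auto
      also have "\<dots> = real n powr (real (fk k) / 3)" using n by (simp add: powr_powr powr_realpow[symmetric])
      finally have "size_bound k P n \<le> real n powr (real (fk k) / 3) * real n powr (x / 3) * real n powr (y / 3)"
        unfolding size_bound_def using root[OF c0] root[OF ck] by (intro mult_mono) auto
      also have "\<dots> = real n powr s" unfolding s_def by (simp add: powr_add[symmetric] add_divide_distrib)
      finally have sb: "size_bound k P n \<le> real n powr s" .
      have "real (Ck k \<delta> P) \<le> K * real m ^ c * size_bound k P n"
        using chain_boundD[OF cb adm] unfolding K_def c_def .
      also have "\<dots> \<le> K * (4 * ln (real n)) ^ c * real n powr s"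
        using K m4 sb n by (intro mult_mono power_mono mult_left_mono) auto
      finally show ?thesis .
    qed
    have "Ck_max k \<delta> (sizes k x y n) \<le> K * (4 * ln (real n)) ^ c * real n powr s"
      unfolding Ck_max_def
    \<comment> \<open>A supremum of reals is controlled only over a nonempty set; the family of
      empty point sets is a member.\<close>
    proof (rule cSup_least)
      have "\<forall>i\<le>k. finite ({} :: (real \<times> real) set) \<and> real (card ({} :: (real \<times> real) set)) \<le> sizes k x y n i"
        by (auto simp: sizes_def)
      then show "{real (Ck k \<delta> P) |P. \<forall>i\<le>k. finite (P i) \<and> real (card (P i)) \<le> sizes k x y n i} \<noteq> {}"
        by (auto intro!: exI[of _ "\<lambda>_. {}"])
    qed (use le in blast)
    moreover have "0 < real n powr s" using n by simp
    ultimately have "Ck_max k \<delta> (sizes k x y n) / real n powr s \<le> K * (4 * ln (real n)) ^ c"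
      by (simp add: divide_le_eq)
    also have "\<dots> = K * 4 ^ c * ln (real n) powr real c"
      using n by (simp add: powr_realpow power_mult_distrib)
    finally show ?thesis unfolding s_def .
  qed
  have "\<forall>\<^sub>F n in sequentially. Ck_max k \<delta> (sizes k x y n) / real n powr ((real (fk k) + x + y) / 3)
      \<le> K * 4 ^ c * ln (real n) powr real c"
    using eventually_ge_at_top[of 2] by (rule eventually_mono) (rule bound)
  moreover have "real c > 0" "K * 4 ^ c > 0" using K c by auto
  ultimately show ?thesis by blast
qed

end
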